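(* Let $T$ be a tree of order $n\geq 8$ and let $\mu\neq 1$ be a Laplacian eigenvalue of $T$. Then $m_T(\mu)=\frac{n}{2}-2$ if and only if $T\cong T\!\left(\frac{n}{2},\frac{n}{2}-1\right)$ and $\mu=\frac{3\pm\sqrt{5}}{2}$. In particular, in this case $\mu$ is the algebraic connectivity $\mu_2(T)$ of $T$ or its conjugate.
   Context: For a graph $G$ on $n$ vertices, the Laplacian matrix is $L(G)=D(G)-A(G)$, with $D(G)$ the diagonal degree matrix and $A(G)$ the adjacency matrix. Its eigenvalues are denoted $0=\mu_1(G)\leq\mu_2(G)\leq\cdots\leq\mu_n(G)$; $\mu_2(G)$ is the algebraic connectivity, and $m_G(\mu)$ denotes the multiplicity of $\mu$ as an eigenvalue of $L(G)$. Two Laplacian eigenvalues are conjugates if they are roots of the same irreducible (over $\mathbb{Q}$) factor of the characteristic polynomial of $L(G)$. For integers $1\leq k\leq s$, the spider $T(s,k)$ is the tree obtained from the star $K_{1,s}$ by extending $k$ of its $s$ rays by one extra edge each; it has $s+k+1$ vertices. *)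

theory Defs
  imports "Jordan_Normal_Form.Char_Poly" "HOL-Computational_Algebra.Polynomial_Factorial"
    "HOL-Library.Multiset"
begin

text \<open>A (simple) graph on the vertex set {0..<n} is given by an adjacency
  predicate E; only its restriction to {0..<n} matters.\<close>

definition simple_graph :: "nat \<Rightarrow> (nat \<Rightarrow> nat \<Rightarrow> bool) \<Rightarrow> bool" where
  "simple_graph n E \<longleftrightarrow> (\<forall>i<n. \<forall>j<n. E i j \<longleftrightarrow> E j i) \<and> (\<forall>i<n. \<not> E i i)"

definition graph_edges :: "nat \<Rightarrow> (nat \<Rightarrow> nat \<Rightarrow> bool) \<Rightarrow> (nat \<times> nat) set" where
  "graph_edges n E = {(i, j). i < j \<and> j < n \<and> E i j}"

definition connected_graph :: "nat \<Rightarrow> (nat \<Rightarrow> nat \<Rightarrow> bool) \<Rightarrow> bool" where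
  "connected_graph n E \<longleftrightarrow>
     (\<forall>i<n. \<forall>j<n. (\<lambda>a b. a < n \<and> b < n \<and> E a b)\<^sup>*\<^sup>* i j)"

definition is_tree :: "nat \<Rightarrow> (nat \<Rightarrow> nat \<Rightarrow> bool) \<Rightarrow> bool" where
  "is_tree n E \<longleftrightarrow> n \<ge> 1 \<and> simple_graph n E \<and> connected_graph n E
      \<and> card (graph_edges n E) = n - 1"

definition graph_iso ::
  "nat \<Rightarrow> (nat \<Rightarrow> nat \<Rightarrow> bool) \<Rightarrow> nat \<Rightarrow> (nat \<Rightarrow> nat \<Rightarrow> bool) \<Rightarrow> bool" where
  "graph_iso n E n' E' \<longleftrightarrow> (\<exists>f. bij_betw f {..<n} {..<n'} \<and>
      (\<forall>i<n. \<forall>j<n. E i j \<longleftrightarrow> E' (f i) (f j)))"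

definition laplacian :: "nat \<Rightarrow> (nat \<Rightarrow> nat \<Rightarrow> bool) \<Rightarrow> 'a :: comm_ring_1 mat" where
  "laplacian n E = mat n n (\<lambda>(i, j).
     if i = j then of_nat (card {k. k < n \<and> E i k})
     else if E i j then -1 else 0)"

definition lap_mult :: "nat \<Rightarrow> (nat \<Rightarrow> nat \<Rightarrow> bool) \<Rightarrow> real \<Rightarrow> nat" where
  "lap_mult n E \<mu> = order \<mu> (char_poly (laplacian n E :: real mat))"

definition lap_spectrum :: "nat \<Rightarrow> (nat \<Rightarrow> nat \<Rightarrow> bool) \<Rightarrow> real list" where
  "lap_spectrum n E = sorted_list_of_multiset (proots (char_poly (laplacian n E :: real mat)))"

definition alg_conn :: "nat \<Rightarrow> (nat \<Rightarrow> nat \<Rightarrow> bool) \<Rightarrow> real" where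
  "alg_conn n E = lap_spectrum n E ! 1"

definition lap_conjugates :: "nat \<Rightarrow> (nat \<Rightarrow> nat \<Rightarrow> bool) \<Rightarrow> real \<Rightarrow> real \<Rightarrow> bool" where
  "lap_conjugates n E a b \<longleftrightarrow> (\<exists>p :: rat poly. irreducible p \<and>
     p dvd char_poly (laplacian n E :: rat mat) \<and>
     poly (map_poly of_rat p) a = 0 \<and> poly (map_poly of_rat p) b = 0)"

text \<open>Spider T(s,k): centre 0, rays 1..s adjacent to 0, and for 1 \<le> i \<le> k
  the vertex s+i is adjacent to i.  Vertex set {0..<s+k+1}.\<close>
definition spider_adj :: "nat \<Rightarrow> nat \<Rightarrow> nat \<Rightarrow> nat \<Rightarrow> bool" where
  "spider_adj s k u v \<longleftrightarrow>
     (u = 0 \<and> 1 \<le> v \<and> v \<le> s) \<or> (v = 0 \<and> 1 \<le> u \<and> u \<le> s) \<or>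
     (1 \<le> u \<and> u \<le> k \<and> v = s + u) \<or> (1 \<le> v \<and> v \<le> k \<and> u = s + v)"

end

theory Submission
  imports Defs "HOL-Computational_Algebra.Field_as_Ring"
begin

text \<open>
  Call a vertex set S determining for \<open>\<mu>\<close> if only the zero eigenfunction vanishes on S. Since the
  Laplacian is symmetric, the multiplicity of \<open>\<mu>\<close> is the size of any minimal determining set, so it
  suffices to find small determining sets.

  For a tree rooted at \<open>r\<close> and \<open>\<mu> \<noteq> 1\<close>, eigenfunctions propagate from the bottom up: they are determined
  by the twigs, i.e. the non-root vertices with children all of whose children are leaves. If the
  root has a twig \<open>p\<close> as a child, \<open>p\<close> can be dropped. Every twig owns a leaf, so multiplicity
  \<open>n/2 - 2\<close> forces the vertex set to be the root, the twigs, one leaf for each twig, and a single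
  further vertex \<open>e\<close>. A pendant path of two vertices attached at \<open>c\<close>, with end \<open>l\<close>, gives
  \<open>x c = (\<mu>\<^sup>2 - 3\<mu> + 1) x l\<close>. If \<open>\<mu>\<^sup>2 - 3\<mu> + 1 \<noteq> 0\<close>, the root alone is determining; otherwise two twigs can be
  omitted unless \<open>e\<close> is a leaf at the root, which is the spider.
\<close>

section \<open>Multiplicities and determining sets\<close>

definition determining :: "'a :: comm_ring_1 mat \<Rightarrow> 'a \<Rightarrow> nat set \<Rightarrow> bool" where
  "determining A \<mu> S \<longleftrightarrow> (\<forall>y \<in> carrier_vec (dim_row A).
     A *\<^sub>v y = \<mu> \<cdot>\<^sub>v y \<longrightarrow> (\<forall>s\<in>S. y $ s = 0) \<longrightarrow> y = 0\<^sub>v (dim_row A))"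

text \<open>
  Let \<open>P\<close> have the columns \<open>xs s\<close> for \<open>s \<in> S\<close> and unit vectors elsewhere. In \<open>(X - A) P\<close> the columns in
  \<open>S\<close> are \<open>(X - \<mu>) xs s\<close>; dividing these by \<open>X - \<mu>\<close> leaves a matrix \<open>M\<close>. Symmetry makes \<open>M\<close> nonsingular
  at \<open>\<mu>\<close>, because a vector in both the kernel and the image of \<open>A - \<mu>\<close> is orthogonal to itself.
\<close>
lemma order_char_poly_symmetric:
  fixes A :: "'a :: linordered_field mat"
  assumes A: "A \<in> carrier_mat n n" and sym: "transpose_mat A = A"
    and S: "S \<subseteq> {..<n}" and det: "determining A \<mu> S"
    and xc: "\<And>s. s \<in> S \<Longrightarrow> xs s \<in> carrier_vec n"
    and xe: "\<And>s. s \<in> S \<Longrightarrow> A *\<^sub>v xs s = \<mu> \<cdot>\<^sub>v xs s"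
    and xd: "\<And>s t. s \<in> S \<Longrightarrow> t \<in> S \<Longrightarrow> xs s $ t = (if s = t then 1 else 0)"
  shows "order \<mu> (char_poly A) = card S"
proof -
  have finS: "finite S" using S finite_subset by blast
  define P where "P = mat n n (\<lambda>(i,j). if j \<in> S then xs j $ i else if i = j then 1 else 0)"
  define D where "D = mat n n (\<lambda>(i,j). if i = j then (if j \<in> S then [:-\<mu>,1:] else 1) else 0)"
  define M where "M = mat n n (\<lambda>(i,j). if j \<in> S then [: xs j $ i :] else char_poly_matrix A $$ (i,j))"
  have Pc: "P \<in> carrier_mat n n" and Dc: "D \<in> carrier_mat n n" and Mc: "M \<in> carrier_mat n n"
    by (auto simp: P_def D_def M_def)
  have CA: "char_poly_matrix A \<in> carrier_mat n n" using A by auto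
  have CAe: "char_poly_matrix A $$ (i,j) = (if i = j then [:0,1:] else 0) - [:A $$ (i,j):]"
    if "i < n" "j < n" for i j using A that by (auto simp: char_poly_matrix_def)
  have Ax: "(\<Sum>k<n. A $$ (i,k) * xs j $ k) = \<mu> * xs j $ i" if "j \<in> S" "i < n" for i j
  proof -
    have "(A *\<^sub>v xs j) $ i = (\<Sum>k<n. A $$ (i,k) * xs j $ k)"
      using A that xc[of j] by (auto simp: scalar_prod_def atLeast0LessThan row_def intro!: sum.cong)
    thus ?thesis using xe[OF that(1)] xc[OF that(1)] that by auto
  qed
  have eq: "char_poly_matrix A * map_mat (\<lambda>a. [:a:]) P = M * D"
  proof (rule eq_matI)
    fix i j assume "i < dim_row (M * D)" "j < dim_col (M * D)"
    hence i: "i < n" and j: "j < n" using Mc Dc by auto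
    have L: "(char_poly_matrix A * map_mat (\<lambda>a. [:a:]) P) $$ (i,j)
       = (\<Sum>k<n. char_poly_matrix A $$ (i,k) * [: P $$ (k,j) :])"
      using CA Pc i j by (auto simp: scalar_prod_def atLeast0LessThan row_def col_def intro!: sum.cong)
    have R: "(M * D) $$ (i,j) = (\<Sum>k<n. M $$ (i,k) * D $$ (k,j))"
      using Mc Dc i j by (auto simp: scalar_prod_def atLeast0LessThan row_def col_def intro!: sum.cong)
    also have "\<dots> = (\<Sum>k<n. if k = j then M $$ (i,j) * D $$ (j,j) else 0)"
      by (rule sum.cong) (use j in \<open>auto simp: D_def\<close>)
    also have "\<dots> = M $$ (i,j) * D $$ (j,j)" using j by simp
    finally have R': "(M * D) $$ (i,j) = M $$ (i,j) * D $$ (j,j)" .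
    show "(char_poly_matrix A * map_mat (\<lambda>a. [:a:]) P) $$ (i,j) = (M * D) $$ (i,j)"
    proof (cases "j \<in> S")
      case True
      have "(\<Sum>k<n. char_poly_matrix A $$ (i,k) * [: P $$ (k,j) :])
         = (\<Sum>k<n. (if i = k then [:0,1:] * [:xs j $ i:] else 0) - [:A $$ (i,k) * xs j $ k:])"
        by (rule sum.cong) (use i j True in \<open>auto simp: CAe P_def\<close>)
      also have "\<dots> = [:0,1:] * [:xs j $ i:] - (\<Sum>k<n. [:A $$ (i,k) * xs j $ k:])"
        using i by (simp add: sum_subtractf)
      also have "(\<Sum>k<n. [:A $$ (i,k) * xs j $ k:]) = [:\<Sum>k<n. A $$ (i,k) * xs j $ k:]"
        by (induction n) auto
      also have "[:0,1:] * [:xs j $ i:] - [:\<Sum>k<n. A $$ (i,k) * xs j $ k:] = M $$ (i,j) * D $$ (j,j)"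
        unfolding Ax[OF True i] using i j True by (simp add: M_def D_def)
      finally show ?thesis using L R' by simp
    next
      case False
      have "(\<Sum>k<n. char_poly_matrix A $$ (i,k) * [: P $$ (k,j) :])
         = (\<Sum>k<n. if k = j then char_poly_matrix A $$ (i,j) else 0)"
        by (rule sum.cong) (use i j False in \<open>auto simp: P_def\<close>)
      also have "\<dots> = char_poly_matrix A $$ (i,j)" using j by simp
      also have "\<dots> = M $$ (i,j) * D $$ (j,j)" using i j False by (simp add: M_def D_def)
      finally show ?thesis using L R' by simp
    qed
  qed (use CA Pc Mc Dc in auto)
  have detD: "det D = [:-\<mu>,1:] ^ card S"
  proof -
    have "det D = prod_list (diag_mat D)"
      by (rule det_upper_triangular[OF _ Dc]) (auto simp: D_def)
    also have "\<dots> = (\<Prod>i\<in>{0..<n}. if i \<in> S then [:-\<mu>,1:] else 1)"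
      unfolding prod_list_diag_prod by (rule prod.cong) (auto simp: D_def)
    also have "\<dots> = (\<Prod>i\<in>{0..<n} \<inter> S. [:-\<mu>,1:])"
      by (rule prod.inter_restrict[symmetric]) simp
    also have "{0..<n} \<inter> S = S" using S by auto
    finally show ?thesis by simp
  qed
  have cph: "comm_ring_hom (\<lambda>a::'a. [:a:])" by standard (auto simp: one_pCons)
  have "det (char_poly_matrix A) * det (map_mat (\<lambda>a. [:a:]) P) = det M * det D"
    using arg_cong[OF eq, of det] CA Pc Mc Dc by (simp add: det_mult[of _ n])
  hence prod_eq: "char_poly A * [:det P:] = det M * [:-\<mu>,1:] ^ card S"
    unfolding detD comm_ring_hom.hom_det[OF cph] char_poly_def .
  \<comment> \<open>The rows of \<open>P\<close> indexed by \<open>S\<close> are unit rows by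
    \<open>xd\<close>, so a kernel vector vanishes on \<open>S\<close>; on such a vector every other
    row acts as a unit row too.\<close>
  have detP: "det P \<noteq> 0"
  proof
    assume "det P = 0"
    then obtain v where v: "v \<in> carrier_vec n" "v \<noteq> 0\<^sub>v n" "P *\<^sub>v v = 0\<^sub>v n"
      using det_0_iff_vec_prod_zero[OF Pc] by auto
    have Pv: "(\<Sum>k<n. P $$ (i,k) * v $ k) = 0" if "i < n" for i
    proof -
      have "(P *\<^sub>v v) $ i = (\<Sum>k<n. P $$ (i,k) * v $ k)"
        using Pc that v(1) by (auto simp: scalar_prod_def atLeast0LessThan row_def intro!: sum.cong)
      thus ?thesis using v that by auto
    qed
    have vS: "v $ t = 0" if "t \<in> S" for t
    proof -
      have t: "t < n" using that S by auto
      have "(\<Sum>k<n. P $$ (t,k) * v $ k) = (\<Sum>k<n. if k = t then v $ t else 0)"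
        by (rule sum.cong) (use that t xd in \<open>auto simp: P_def\<close>)
      thus ?thesis using Pv[OF t] t by simp
    qed
    have "v $ t = 0" if t: "t < n" for t
    proof -
      have "(\<Sum>k<n. P $$ (t,k) * v $ k) = (\<Sum>k<n. if k = t then v $ t else 0)"
        by (rule sum.cong) (use t vS in \<open>auto simp: P_def\<close>)
      thus ?thesis using Pv[OF t] t by simp
    qed
    hence "v = 0\<^sub>v n" using v(1) by (intro eq_vecI) auto
    with v(2) show False by simp
  qed
  have detM: "poly (det M) \<mu> \<noteq> 0"
  proof
    define M' where "M' = map_mat (\<lambda>p. poly p \<mu>) M"
    have M'c: "M' \<in> carrier_mat n n" using Mc by (auto simp: M'_def)
    have ph: "comm_ring_hom (\<lambda>p. poly p \<mu>)" by standard auto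
    assume "poly (det M) \<mu> = 0"
    hence "det M' = 0" unfolding M'_def comm_ring_hom.hom_det[OF ph] .
    then obtain v where v: "v \<in> carrier_vec n" "v \<noteq> 0\<^sub>v n" "M' *\<^sub>v v = 0\<^sub>v n"
      using det_0_iff_vec_prod_zero[OF M'c] by auto
    \<comment> \<open>A kernel vector \<open>v\<close> of \<open>M\<close> at \<mu> splits into its
      part \<open>y\<close> outside \<open>S\<close> and the combination \<open>z\<close> of the
      eigenvectors \<open>xs\<close>. With \<open>B\<close> as below, \<open>M' v = 0\<close> reads
      \<open>B y = z\<close>, while \<open>B z = 0\<close>. Symmetry moves \<open>B\<close> from
      \<open>y\<close> to \<open>z\<close> in the sum of squares of \<open>z\<close>, which is
      therefore zero; here the order of the field is used.\<close>
    define y where "y = vec n (\<lambda>k. if k \<in> S then 0 else v $ k)"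
    define z where "z = vec n (\<lambda>i. \<Sum>k\<in>S. v $ k * xs k $ i)"
    have yc: "y \<in> carrier_vec n" and zc: "z \<in> carrier_vec n" by (auto simp: y_def z_def)
    define B where "B = A - \<mu> \<cdot>\<^sub>m 1\<^sub>m n"
    have Bc: "B \<in> carrier_mat n n" using A by (auto simp: B_def)
    have Bs: "B $$ (i,j) = B $$ (j,i)" if "i < n" "j < n" for i j
    proof -
      have "A $$ (i,j) = transpose_mat A $$ (j,i)" using A that by auto
      thus ?thesis using A that sym by (auto simp: B_def)
    qed
    have By: "z $ i = (\<Sum>k<n. B $$ (i,k) * y $ k)" if i: "i < n" for i
    proof -
      have "(M' *\<^sub>v v) $ i = (\<Sum>k<n. M' $$ (i,k) * v $ k)"
        using M'c i v(1) by (auto simp: scalar_prod_def atLeast0LessThan row_def intro!: sum.cong)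
      hence "0 = (\<Sum>k<n. M' $$ (i,k) * v $ k)" using v i by auto
      also have "\<dots> = (\<Sum>k<n. (if k \<in> S then v $ k * xs k $ i else 0) - B $$ (i,k) * y $ k)"
      proof (rule sum.cong[OF refl])
        fix k assume "k \<in> {..<n}"
        hence k: "k < n" by simp
        have "M' $$ (i,k) = - B $$ (i,k)" if "k \<notin> S"
          using that i k A by (auto simp: M'_def M_def CAe B_def)
        moreover have "M' $$ (i,k) = xs k $ i" if "k \<in> S"
          using that i k by (simp add: M'_def M_def)
        ultimately show "M' $$ (i,k) * v $ k = (if k \<in> S then v $ k * xs k $ i else 0) - B $$ (i,k) * y $ k"
          using k by (cases "k \<in> S") (simp_all add: y_def)
      qed
      also have "\<dots> = (\<Sum>k<n. (if k \<in> S then v $ k * xs k $ i else 0)) - (\<Sum>k<n. B $$ (i,k) * y $ k)"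
        by (simp add: sum_subtractf)
      also have "(\<Sum>k<n. (if k \<in> S then v $ k * xs k $ i else 0)) = (\<Sum>k\<in>{..<n} \<inter> S. v $ k * xs k $ i)"
        by (simp add: sum.inter_restrict)
      also have "{..<n} \<inter> S = S" using S by auto
      finally show ?thesis using i by (simp add: z_def)
    qed
    have Ay: "(A *\<^sub>v y) $ i = \<mu> * y $ i + z $ i" if i: "i < n" for i
    proof -
      have "(A *\<^sub>v y) $ i = (\<Sum>k<n. A $$ (i,k) * y $ k)"
        using A i yc by (auto simp: scalar_prod_def atLeast0LessThan row_def intro!: sum.cong)
      also have "\<dots> = (\<Sum>k<n. B $$ (i,k) * y $ k + (if k = i then \<mu> * y $ i else 0))"
        by (rule sum.cong) (use i A in \<open>auto simp: B_def algebra_simps\<close>)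
      also have "\<dots> = z $ i + \<mu> * y $ i" using i By by (simp add: sum.distrib)
      finally show ?thesis by simp
    qed
    have Bz: "(\<Sum>i<n. B $$ (k,i) * z $ i) = 0" if k: "k < n" for k
    proof -
      have "(\<Sum>i<n. B $$ (k,i) * xs s $ i) = 0" if s: "s \<in> S" for s
      proof -
        have "(\<Sum>i<n. B $$ (k,i) * xs s $ i)
          = (\<Sum>i<n. A $$ (k,i) * xs s $ i - (if i = k then \<mu> * xs s $ k else 0))"
          by (rule sum.cong) (use k A in \<open>auto simp: B_def algebra_simps\<close>)
        also have "\<dots> = 0" using k Ax[OF s k] by (simp add: sum_subtractf)
        finally show ?thesis .
      qed
      note Bx = this
      have "(\<Sum>i<n. B $$ (k,i) * z $ i) = (\<Sum>i<n. \<Sum>s\<in>S. v $ s * (B $$ (k,i) * xs s $ i))"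
        by (rule sum.cong) (auto simp: z_def sum_distrib_left algebra_simps)
      also have "\<dots> = (\<Sum>s\<in>S. v $ s * (\<Sum>i<n. B $$ (k,i) * xs s $ i))"
        by (subst sum.swap) (simp add: sum_distrib_left)
      also have "\<dots> = 0" using Bx by simp
      finally show ?thesis .
    qed
    have "(\<Sum>i<n. z $ i * z $ i) = (\<Sum>i<n. \<Sum>k<n. y $ k * (B $$ (k,i) * z $ i))"
    proof (rule sum.cong[OF refl])
      fix i assume "i \<in> {..<n}"
      hence i: "i < n" by simp
      have "z $ i * z $ i = (\<Sum>k<n. B $$ (i,k) * y $ k) * z $ i" using By[OF i] by simp
      also have "\<dots> = (\<Sum>k<n. y $ k * (B $$ (k,i) * z $ i))"
        unfolding sum_distrib_right by (rule sum.cong) (use Bs i in \<open>auto simp: mult_ac\<close>)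
      finally show "z $ i * z $ i = (\<Sum>k<n. y $ k * (B $$ (k,i) * z $ i))" .
    qed
    also have "\<dots> = (\<Sum>k<n. y $ k * (\<Sum>i<n. B $$ (k,i) * z $ i))"
      by (subst sum.swap) (simp add: sum_distrib_left)
    also have "\<dots> = 0" using Bz by simp
    finally have "\<forall>i\<in>{..<n}. z $ i * z $ i = 0"
      by (subst (asm) sum_nonneg_eq_0_iff) auto
    hence z0: "z $ i = 0" if "i < n" for i using that by auto
    have "A *\<^sub>v y = \<mu> \<cdot>\<^sub>v y"
      by (rule eq_vecI) (use A yc z0 in \<open>auto simp: Ay simp del: index_mult_mat_vec\<close>)
    moreover have "\<forall>s\<in>S. y $ s = 0" using S by (auto simp: y_def)
    ultimately have y0: "y = 0\<^sub>v n" using det A yc unfolding determining_def by auto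
    have vn: "v $ k = 0" if "k < n" "k \<notin> S" for k
    proof -
      have "y $ k = v $ k" using that by (simp add: y_def)
      thus ?thesis unfolding y0 using that(1) by simp
    qed
    \<comment> \<open>By \<open>xd\<close> the entry of \<open>z\<close> at \<open>t\<close> is just
      the coefficient \<open>v $ t\<close>.\<close>
    have "v $ t = 0" if t: "t \<in> S" for t
    proof -
      have tn: "t < n" using t S by auto
      have "0 = (\<Sum>k\<in>S. v $ k * xs k $ t)" using z0[OF tn] tn by (simp add: z_def)
      also have "\<dots> = (\<Sum>k\<in>S. if k = t then v $ t else 0)"
        by (rule sum.cong) (use t xd in auto)
      also have "\<dots> = v $ t" using t finS by simp
      finally show ?thesis by simp
    qed
    hence "v = 0\<^sub>v n" using v(1) vn by (intro eq_vecI) auto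
    with v(2) show False by simp
  qed
  have M0: "det M \<noteq> 0" using detM by auto
  have cp0: "char_poly A \<noteq> 0" using degree_monic_char_poly[OF A] by auto
  have "order \<mu> (char_poly A * [:det P:]) = order \<mu> (char_poly A) + order \<mu> [:det P:]"
    by (rule order_mult) (use cp0 detP in auto)
  also have "order \<mu> [:det P:] = 0" using detP by (intro order_0I) auto
  finally have "order \<mu> (char_poly A) = order \<mu> (det M * [:-\<mu>,1:] ^ card S)"
    using prod_eq by simp
  also have "\<dots> = order \<mu> (det M) + order \<mu> ([:-\<mu>,1:] ^ card S)"
    by (rule order_mult) (use M0 in auto)
  also have "order \<mu> (det M) = 0" using detM by (rule order_0I)
  also have "order \<mu> ([:-\<mu>,1:] ^ card S) = card S" by (rule order_power_n_n)
  finally show ?thesis by simp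
qed

text \<open>An inclusion-minimal determining set carries a dual basis: dropping \<open>s\<close>
  admits a nonzero eigenvector vanishing on the rest. It cannot vanish at \<open>s\<close> as well,
  so it scales to 1 there. These are the \<open>xs\<close> of
  \<open>order_char_poly_symmetric\<close>.\<close>

lemma order_char_poly_determining:
  fixes A :: "'a :: linordered_field mat"
  assumes A: "A \<in> carrier_mat n n" and sym: "transpose_mat A = A"
    and S: "S \<subseteq> {..<n}" and det: "determining A \<mu> S"
  obtains S' where "S' \<subseteq> S" "determining A \<mu> S'" "order \<mu> (char_poly A) = card S'"
proof -
  have fS: "finite S" using S finite_subset by blast
  let ?F = "{T. T \<subseteq> S \<and> determining A \<mu> T}"
  have "finite ?F" "S \<in> ?F" using fS det by auto
  then obtain T where T: "T \<in> ?F" and Tmin: "\<And>U. U \<in> ?F \<Longrightarrow> U \<le> T \<Longrightarrow> T = U"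
    using finite_has_minimal2[of ?F S] by metis
  have TS: "T \<subseteq> S" "determining A \<mu> T" using T by auto
  have "\<exists>x \<in> carrier_vec n. A *\<^sub>v x = \<mu> \<cdot>\<^sub>v x \<and> (\<forall>t\<in>T. x $ t = (if s = t then 1 else 0))"
    if s: "s \<in> T" for s
  proof -
    have "T - {s} \<notin> ?F" using Tmin[of "T - {s}"] s by auto
    hence "\<not> determining A \<mu> (T - {s})" using TS by auto
    then obtain y where y: "y \<in> carrier_vec n" "A *\<^sub>v y = \<mu> \<cdot>\<^sub>v y"
      "\<forall>t\<in>T - {s}. y $ t = 0" "y \<noteq> 0\<^sub>v n"
      using A unfolding determining_def by auto
    have ys: "y $ s \<noteq> 0"
    proof
      assume "y $ s = 0"
      hence "\<forall>t\<in>T. y $ t = 0" using y(3) by auto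
      with TS(2) y A show False unfolding determining_def by auto
    qed
    have sn: "T \<subseteq> {..<n}" using TS S by auto
    define x where "x = inverse (y $ s) \<cdot>\<^sub>v y"
    have "A *\<^sub>v x = \<mu> \<cdot>\<^sub>v x"
      unfolding x_def using A y(1) by (simp add: mult_mat_vec[OF A y(1)] y(2) smult_smult_assoc mult.commute)
    moreover have "\<forall>t\<in>T. x $ t = (if s = t then 1 else 0)"
      using ys y(1,3) sn s by (auto simp: x_def)
    ultimately show ?thesis using y(1) by (auto simp: x_def)
  qed
  then obtain xs where "\<And>s. s \<in> T \<Longrightarrow> xs s \<in> carrier_vec n \<and> A *\<^sub>v xs s = \<mu> \<cdot>\<^sub>v xs s \<and>
     (\<forall>t\<in>T. xs s $ t = (if s = t then 1 else 0))" by metis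
  hence "order \<mu> (char_poly A) = card T"
    by (intro order_char_poly_symmetric[OF A sym _ TS(2), of xs]) (use TS S in auto)
  thus ?thesis using that TS by blast
qed

section \<open>Laplacian eigenfunctions\<close>

abbreviation nbrs :: "nat \<Rightarrow> (nat \<Rightarrow> nat \<Rightarrow> bool) \<Rightarrow> nat \<Rightarrow> nat set" where
  "nbrs n E v \<equiv> {k. k < n \<and> E v k}"

text \<open>Functions on all of \<open>nat\<close>, unconstrained from \<open>n\<close> on and
  possibly zero, take the place of vectors, so that later arguments run pointwise without
  dimensions.\<close>

definition lap_eigenfun :: "nat \<Rightarrow> (nat \<Rightarrow> nat \<Rightarrow> bool) \<Rightarrow> real \<Rightarrow> (nat \<Rightarrow> real) \<Rightarrow> bool" where
  "lap_eigenfun n E \<mu> x \<longleftrightarrow>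
     (\<forall>v<n. real (card (nbrs n E v)) * x v - sum x (nbrs n E v) = \<mu> * x v)"

definition lap_determining :: "nat \<Rightarrow> (nat \<Rightarrow> nat \<Rightarrow> bool) \<Rightarrow> real \<Rightarrow> nat set \<Rightarrow> bool" where
  "lap_determining n E \<mu> S \<longleftrightarrow>
     (\<forall>x. lap_eigenfun n E \<mu> x \<longrightarrow> (\<forall>s\<in>S. x s = 0) \<longrightarrow> (\<forall>v<n. x v = 0))"

lemma lap_determiningI:
  assumes "\<And>x v. lap_eigenfun n E \<mu> x \<Longrightarrow> (\<And>s. s \<in> S \<Longrightarrow> x s = 0) \<Longrightarrow> v < n \<Longrightarrow> x v = 0"
  shows "lap_determining n E \<mu> S"
  using assms unfolding lap_determining_def by blast

lemma laplacian_carrier [simp]: "laplacian n E \<in> carrier_mat n n"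
  by (simp add: laplacian_def)

lemma laplacian_mult_vec:
  assumes "simple_graph n E" "y \<in> carrier_vec n" "v < n"
  shows "((laplacian n E :: real mat) *\<^sub>v y) $ v
    = real (card (nbrs n E v)) * y $ v - sum (($) y) (nbrs n E v)"
proof -
  have "((laplacian n E :: real mat) *\<^sub>v y) $ v = (\<Sum>k<n. (laplacian n E :: real mat) $$ (v,k) * y $ k)"
    using assms carrier_matD[OF laplacian_carrier[of n E, where 'a=real]]
    by (auto simp: scalar_prod_def atLeast0LessThan row_def intro!: sum.cong)
  also have "\<dots> = (\<Sum>k<n. (if k = v then real (card (nbrs n E v)) * y $ v else 0)
       - (if k \<in> nbrs n E v then y $ k else 0))"
    by (rule sum.cong) (use assms in \<open>auto simp: laplacian_def simple_graph_def\<close>)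
  also have "\<dots> = real (card (nbrs n E v)) * y $ v - (\<Sum>k<n. if k \<in> nbrs n E v then y $ k else 0)"
    using assms(3) by (simp add: sum_subtractf)
  also have "(\<Sum>k<n. if k \<in> nbrs n E v then y $ k else 0) = sum (($) y) ({..<n} \<inter> nbrs n E v)"
    by (rule sum.inter_restrict[symmetric]) simp
  also have "{..<n} \<inter> nbrs n E v = nbrs n E v" by auto
  finally show ?thesis .
qed

lemma laplacian_symmetric:
  "simple_graph n E \<Longrightarrow> transpose_mat (laplacian n E) = laplacian n E"
  by (rule eq_matI) (auto simp: laplacian_def simple_graph_def)

lemma determining_laplacian_iff:
  assumes sg: "simple_graph n E" and S: "S \<subseteq> {..<n}"
  shows "determining (laplacian n E :: real mat) \<mu> S \<longleftrightarrow> lap_determining n E \<mu> S"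
proof -
  let ?L = "laplacian n E :: real mat"
  have dim: "dim_row ?L = n" by (simp add: laplacian_def)
  have ev: "?L *\<^sub>v y = \<mu> \<cdot>\<^sub>v y \<longleftrightarrow> lap_eigenfun n E \<mu> (($) y)" if y: "y \<in> carrier_vec n" for y
  proof -
    have "?L *\<^sub>v y = \<mu> \<cdot>\<^sub>v y \<longleftrightarrow> (\<forall>v<n. (?L *\<^sub>v y) $ v = \<mu> * y $ v)"
      using y dim by (auto simp: vec_eq_iff simp del: index_mult_mat_vec)
    thus ?thesis unfolding lap_eigenfun_def using laplacian_mult_vec[OF sg y] by simp
  qed
  have cong: "lap_eigenfun n E \<mu> (($) (vec n x)) \<longleftrightarrow> lap_eigenfun n E \<mu> x" for x
  proof -
    have "sum (($) (vec n x)) (nbrs n E v) = sum x (nbrs n E v)" for v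
      by (rule sum.cong) auto
    thus ?thesis by (simp add: lap_eigenfun_def)
  qed
  show ?thesis
  proof
    assume d: "determining ?L \<mu> S"
    show "lap_determining n E \<mu> S"
    proof (rule lap_determiningI)
      fix x v assume x: "lap_eigenfun n E \<mu> x" "\<And>s. s \<in> S \<Longrightarrow> x s = 0" and v: "v < n"
      have "\<forall>s\<in>S. vec n x $ s = 0" using x(2) S by auto
      hence "vec n x = 0\<^sub>v n"
        using d ev[of "vec n x"] x(1) dim cong unfolding determining_def by auto
      thus "x v = 0" using v by (metis index_vec index_zero_vec(1))
    qed
  next
    assume d: "lap_determining n E \<mu> S"
    show "determining ?L \<mu> S"
      unfolding determining_def dim
    proof (intro ballI impI)
      fix y assume y: "y \<in> carrier_vec n" "?L *\<^sub>v y = \<mu> \<cdot>\<^sub>v y" "\<forall>s\<in>S. y $ s = 0"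
      hence "\<forall>v<n. y $ v = 0" using d ev[of y] unfolding lap_determining_def by auto
      thus "y = 0\<^sub>v n" using y(1) by (intro eq_vecI) auto
    qed
  qed
qed

lemma lap_mult_determining:
  assumes sg: "simple_graph n E" and S: "S \<subseteq> {..<n}" and d: "lap_determining n E \<mu> S"
  obtains S' where "S' \<subseteq> S" "lap_determining n E \<mu> S'" "lap_mult n E \<mu> = card S'"
proof -
  obtain S' where "S' \<subseteq> S" "determining (laplacian n E) \<mu> S'"
    "order \<mu> (char_poly (laplacian n E)) = card S'"
    using order_char_poly_determining[OF laplacian_carrier laplacian_symmetric[OF sg] S]
      d determining_laplacian_iff[OF sg S] by metis
  thus ?thesis using that determining_laplacian_iff[OF sg, of S'] S
    unfolding lap_mult_def by blast
qed

lemma lap_mult_le: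
  assumes "simple_graph n E" "S \<subseteq> {..<n}" "lap_determining n E \<mu> S"
  shows "lap_mult n E \<mu> \<le> card S"
proof -
  obtain S' where "S' \<subseteq> S" "lap_mult n E \<mu> = card S'"
    using lap_mult_determining[OF assms] by metis
  moreover have "finite S" using assms(2) finite_subset by blast
  ultimately show ?thesis by (simp add: card_mono)
qed

text \<open>The multiplicity is itself the size of some determining set, found by shrinking the full
  vertex set.\<close>

lemma lap_mult_ge:
  assumes "simple_graph n E"
    and "\<And>S. S \<subseteq> {..<n} \<Longrightarrow> lap_determining n E \<mu> S \<Longrightarrow> k \<le> card S"
  shows "k \<le> lap_mult n E \<mu>"
proof -
  have "lap_determining n E \<mu> {..<n}" by (auto simp: lap_determining_def)
  then obtain S' where "S' \<subseteq> {..<n}" "lap_determining n E \<mu> S'" "lap_mult n E \<mu> = card S'"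
    using lap_mult_determining[OF assms(1) order_refl] by metis
  thus ?thesis using assms(2) by simp
qed

section \<open>Local consequences of the eigenvalue equation\<close>

lemma lap_eigenfunD:
  assumes "lap_eigenfun n E \<mu> x" "v < n"
  shows "sum x (nbrs n E v) = (real (card (nbrs n E v)) - \<mu>) * x v"
  using assms unfolding lap_eigenfun_def by (auto simp: algebra_simps)

lemma lap_eigenfun_leaf:
  assumes "lap_eigenfun n E \<mu> x" "v < n" "nbrs n E v = {u}"
  shows "x u = (1 - \<mu>) * x v"
  using lap_eigenfunD[OF assms(1,2)] assms(3) by simp

lemma lap_eigenfun_leaf_zero:
  assumes "lap_eigenfun n E \<mu> x" "v < n" "nbrs n E v = {u}" "x u = 0" "\<mu> \<noteq> 1"
  shows "x v = 0"
  using lap_eigenfun_leaf[OF assms(1-3)] assms(4,5) by simp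

text \<open>This is how vanishing spreads: where \<open>x v = 0\<close>, the neighbours of
  \<open>v\<close> sum to zero, so a single remaining neighbour must vanish.\<close>

lemma lap_eigenfun_nbr_zero:
  assumes "lap_eigenfun n E \<mu> x" "v < n" "x v = 0" "u \<in> nbrs n E v"
    and "\<And>w. w \<in> nbrs n E v \<Longrightarrow> w \<noteq> u \<Longrightarrow> x w = 0"
  shows "x u = 0"
proof -
  have "sum x (nbrs n E v) = sum x {u}"
    by (rule sum.mono_neutral_right) (use assms in auto)
  thus ?thesis using lap_eigenfunD[OF assms(1,2)] assms(3) by simp
qed

text \<open>The equation at \<open>l\<close> gives \<open>x h\<close>, and the one at
  \<open>h\<close> then gives \<open>x c\<close>. At a root of the quadratic the path forces
  \<open>x c = 0\<close>; elsewhere \<open>x c = 0\<close> kills the path.\<close>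

lemma lap_eigenfun_pendant_path:
  assumes x: "lap_eigenfun n E \<mu> x" and "h < n" "l < n" "c \<noteq> l"
    and "nbrs n E h = {c, l}" "nbrs n E l = {h}"
  shows "x h = (1 - \<mu>) * x l" "x c = (\<mu>\<^sup>2 - 3 * \<mu> + 1) * x l"
proof -
  show h: "x h = (1 - \<mu>) * x l" by (rule lap_eigenfun_leaf) fact+
  have "x c + x l = (2 - \<mu>) * x h"
    using lap_eigenfunD[OF x \<open>h < n\<close>] assms by simp
  thus "x c = (\<mu>\<^sup>2 - 3 * \<mu> + 1) * x l" unfolding h by (simp add: algebra_simps power2_eq_square)
qed

lemma tree_simple: "is_tree n E \<Longrightarrow> simple_graph n E"
  by (simp add: is_tree_def)

section \<open>Rooted trees\<close>

text \<open>\<open>par r\<close> is left open, so each clause on parents excludes the root. The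
  depth \<open>d\<close> excludes cycles of parents and is the measure for inductions.\<close>

locale rooted_tree =
  fixes n :: nat and E :: "nat \<Rightarrow> nat \<Rightarrow> bool" and r :: nat and par d :: "nat \<Rightarrow> nat"
  assumes root_less: "r < n" and depth_root: "d r = 0"
    and par_less: "v < n \<Longrightarrow> v \<noteq> r \<Longrightarrow> par v < n"
    and depth_par: "v < n \<Longrightarrow> v \<noteq> r \<Longrightarrow> d v = Suc (d (par v))"
    and adj_iff: "u < n \<Longrightarrow> v < n \<Longrightarrow> E u v \<longleftrightarrow> (u \<noteq> r \<and> v = par u) \<or> (v \<noteq> r \<and> u = par v)"
begin

definition children :: "nat \<Rightarrow> nat set" where
  "children v = {w. w < n \<and> w \<noteq> r \<and> par w = v}"

lemma childrenD: "w \<in> children v \<Longrightarrow> w < n" "w \<in> children v \<Longrightarrow> w \<noteq> r" "w \<in> children v \<Longrightarrow> par w = v"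
  "w \<in> children v \<Longrightarrow> d w = Suc (d v)"
  using depth_par by (auto simp: children_def)

lemma in_children_par: "v < n \<Longrightarrow> v \<noteq> r \<Longrightarrow> v \<in> children (par v)"
  by (simp add: children_def)

lemma nbrs_root: "nbrs n E r = children r"
  using root_less by (auto simp: children_def adj_iff)

lemma nbrs_nonroot: "v < n \<Longrightarrow> v \<noteq> r \<Longrightarrow> nbrs n E v = insert (par v) (children v)"
  using par_less by (auto simp: children_def adj_iff)

lemma lap_eigenfun_childless_zero:
  assumes "lap_eigenfun n E \<mu> x" "\<mu> \<noteq> 1" "v < n" "v \<noteq> r" "children v = {}" "x (par v) = 0"
  shows "x v = 0"
  using lap_eigenfun_leaf_zero[OF assms(1,3) _ assms(6,2)] nbrs_nonroot[OF assms(3,4)] assms(5) by simp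

end

text \<open>Take \<open>d\<close> as the distance from \<open>r\<close> and \<open>par v\<close> as
  the last vertex before \<open>v\<close> on a shortest walk. The edges between \<open>v\<close> and
  \<open>par v\<close> are distinct, and there are \<open>n - 1\<close> of them, so they are all the
  edges of the tree.\<close>

lemma tree_rooted:
  assumes T: "is_tree n E" and r: "r < n"
  obtains par d where "rooted_tree n E r par d"
proof -
  let ?R = "\<lambda>a b. a < n \<and> b < n \<and> E a b"
  define d where "d v = (LEAST k. (?R ^^ k) r v)" for v
  have sg: "simple_graph n E" using T by (simp add: is_tree_def)
  have sym: "E u v \<longleftrightarrow> E v u" if "u < n" "v < n" for u v using sg that by (auto simp: simple_graph_def)
  have ex: "\<exists>k. (?R ^^ k) r v" if "v < n" for v
    using T that r unfolding is_tree_def connected_graph_def by (meson rtranclp_imp_relpowp)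
  have dv: "(?R ^^ d v) r v" if "v < n" for v
    unfolding d_def by (rule LeastI_ex) (rule ex[OF that])
  have dle: "d v \<le> k" if "(?R ^^ k) r v" for v k unfolding d_def by (rule Least_le) (rule that)
  have "\<exists>u. ?R u v \<and> d v = Suc (d u)" if v: "v < n" "v \<noteq> r" for v
  proof -
    have "d v \<noteq> 0" using dv[OF v(1)] v(2) by (auto intro!: Nat.gr0I elim: relpowp_0_E)
    then obtain k where k: "d v = Suc k" by (cases "d v") auto
    obtain u where u: "(?R ^^ k) r u" "?R u v" using dv[OF v(1)] unfolding k by (rule relpowp_Suc_E)
    have "d u \<le> k" using dle[OF u(1)] .
    moreover have "d v \<le> Suc (d u)"
      by (rule dle) (use dv[of u] u in \<open>auto intro: relpowp_Suc_I\<close>)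
    ultimately show ?thesis using k u(2) by (intro exI[of _ u]) auto
  qed
  then obtain par where par: "\<And>v. v < n \<Longrightarrow> v \<noteq> r \<Longrightarrow> ?R (par v) v \<and> d v = Suc (d (par v))"
    by metis
  define F where "F = (\<lambda>v. (min v (par v), max v (par v)))"
  \<comment> \<open>Two vertices with the same edge would be parents of each other, but
    \<open>d\<close> drops strictly at each parent.\<close>
  have inj: "inj_on F ({..<n} - {r})"
  proof (rule inj_onI)
    fix u v assume uv: "u \<in> {..<n} - {r}" "v \<in> {..<n} - {r}" "F u = F v"
    hence "u = v \<or> (u = par v \<and> v = par u)" unfolding F_def
      by (auto simp: min_def max_def split: if_splits)
    thus "u = v" using par[of u] par[of v] uv(1,2) by fastforce
  qed
  have sub: "F ` ({..<n} - {r}) \<subseteq> graph_edges n E"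
  proof
    fix e assume "e \<in> F ` ({..<n} - {r})"
    then obtain v where v: "v < n" "v \<noteq> r" "e = F v" by auto
    have "par v < n" "E (par v) v" "par v \<noteq> v" using par[OF v(1,2)] by auto
    thus "e \<in> graph_edges n E" using v sym[of v "par v"]
      by (auto simp: F_def graph_edges_def min_def max_def)
  qed
  have fin: "finite (graph_edges n E)"
    by (rule finite_subset[of _ "{..<n} \<times> {..<n}"]) (auto simp: graph_edges_def)
  have "card (F ` ({..<n} - {r})) = card (graph_edges n E)"
    using card_image[OF inj] r T by (simp add: is_tree_def)
  hence FE: "F ` ({..<n} - {r}) = graph_edges n E" using card_subset_eq[OF fin sub] by simp
  have adj: "E u v \<longleftrightarrow> (u \<noteq> r \<and> v = par u) \<or> (v \<noteq> r \<and> u = par v)" if uv: "u < n" "v < n" for u v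
  proof
    assume e: "E u v"
    hence "u \<noteq> v" using sg uv by (auto simp: simple_graph_def)
    hence "(min u v, max u v) \<in> graph_edges n E"
      using e uv sym[of u v] by (auto simp: graph_edges_def min_def max_def)
    then obtain w where "w < n" "w \<noteq> r" "F w = (min u v, max u v)" unfolding FE[symmetric] by force
    thus "(u \<noteq> r \<and> v = par u) \<or> (v \<noteq> r \<and> u = par v)"
      by (auto simp: F_def min_def max_def split: if_splits)
  qed (use par sym uv in blast)
  have "d r = 0" using dle[of 0 r] by simp
  hence "rooted_tree n E r par d" by unfold_locales (use r par adj in auto)
  thus ?thesis using that by blast
qed

text \<open>Root at 0 and take a deepest vertex \<open>l\<close>. At depth at most 1 the tree is a
  star; otherwise the parent \<open>p\<close> of \<open>l\<close> has only leaves below it.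
  Re-rooting at \<open>c\<close> later makes \<open>p\<close> a twig attached to the root.\<close>

lemma tree_star_or_inner:
  assumes T: "is_tree n E"
  obtains (star) r where "r < n" "\<And>v. v < n \<Longrightarrow> v \<noteq> r \<Longrightarrow> nbrs n E v = {r}"
  | (inner) c p l where "c < n" "p < n" "c \<in> nbrs n E p" "l \<in> nbrs n E p" "l \<noteq> c"
    "\<And>w. w \<in> nbrs n E p \<Longrightarrow> w \<noteq> c \<Longrightarrow> nbrs n E w = {p}"
proof -
  have n: "0 < n" using T by (simp add: is_tree_def)
  obtain par d where "rooted_tree n E 0 par d" using tree_rooted[OF T n] .
  then interpret rooted_tree n E 0 par d .
  obtain l where l: "l < n" and lmax: "\<And>v. v < n \<Longrightarrow> d v \<le> d l"
  proof -
    have "Max (d ` {..<n}) \<in> d ` {..<n}" by (rule Max_in) (use n in auto)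
    then obtain l where "l < n" "d l = Max (d ` {..<n})" by auto
    thus ?thesis using that[of l] by simp
  qed
  show ?thesis
  proof (cases "d l \<le> 1")
    case True
    have par0: "par v = 0" if v: "v < n" "v \<noteq> 0" for v
    proof (rule ccontr)
      assume "par v \<noteq> 0"
      hence "d v = Suc (Suc (d (par (par v))))" using depth_par v par_less by metis
      thus False using lmax[OF v(1)] True by simp
    qed
    have "nbrs n E v = {0}" if v: "v < n" "v \<noteq> 0" for v
    proof -
      have "children v = {}" using par0 v(2) by (auto simp: children_def)
      thus ?thesis using nbrs_nonroot[OF v] par0[OF v] by simp
    qed
    thus ?thesis using star[of 0] n by blast
  next
    case False
    define p where "p = par l"
    define c where "c = par p"
    have l0: "l \<noteq> 0" using False depth_root by (intro notI) simp
    have p: "p < n" "d l = Suc (d p)" using par_less depth_par l l0 by (auto simp: p_def)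
    have p0: "p \<noteq> 0" using False depth_root p by (intro notI) simp
    have c: "c < n" "d p = Suc (d c)" using par_less depth_par p p0 by (auto simp: c_def)
    have nb: "nbrs n E p = insert c (children p)" using nbrs_nonroot[OF p(1) p0] c_def by simp
    have lp: "l \<in> children p" using in_children_par[OF l l0] p_def by simp
    have "nbrs n E w = {p}" if w: "w \<in> nbrs n E p" "w \<noteq> c" for w
    proof -
      have wp: "w \<in> children p" using w nb by simp
      have "d w = d l" using childrenD(4)[OF wp] p(2) by simp
      hence "children w = {}" using childrenD(1,4)[of _ w] lmax by force
      thus ?thesis using nbrs_nonroot[OF childrenD(1,2)[OF wp]] childrenD(3)[OF wp] by simp
    qed
    moreover have "l \<noteq> c" using p c by auto
    ultimately show ?thesis using inner[of c p l] c(1) p(1) nb lp by simp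
  qed
qed

section \<open>The spectrum of the spider\<close>

text \<open>
  The spider with centre \<open>c\<close>, short ray \<open>e\<close>, and long rays \<open>h\<close>, \<open>g h\<close> for \<open>h \<in> H\<close>; it is
  \<open>T(card H + 1, card H)\<close>.
\<close>
locale spider_at =
  fixes n :: nat and E :: "nat \<Rightarrow> nat \<Rightarrow> bool" and c e :: nat and H :: "nat set" and g :: "nat \<Rightarrow> nat"
  assumes vertices: "{..<n} = insert c (insert e (H \<union> g ` H))"
    and center_not_end: "c \<noteq> e"
    and center_not_leg: "c \<notin> H" "h \<in> H \<Longrightarrow> c \<noteq> g h"
    and end_not_leg: "e \<notin> H" "h \<in> H \<Longrightarrow> e \<noteq> g h"
    and legs_disjoint: "h \<in> H \<Longrightarrow> h' \<in> H \<Longrightarrow> h' \<noteq> g h"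
    and inj_leg: "inj_on g H"
    and nbrs_center: "nbrs n E c = insert e H"
    and nbrs_end: "nbrs n E e = {c}"
    and nbrs_leg: "h \<in> H \<Longrightarrow> nbrs n E h = {c, g h}" "h \<in> H \<Longrightarrow> nbrs n E (g h) = {h}"
begin

lemma vertex_less:
  "c < n" "e < n" "h \<in> H \<Longrightarrow> h < n" "h \<in> H \<Longrightarrow> g h < n"
  using vertices by (metis UnI1 UnI2 image_eqI insertCI lessThan_iff)+

lemma vertex_cases:
  assumes "v < n"
  shows "v = c \<or> v = e \<or> v \<in> H \<or> v \<in> g ` H"
proof -
  have "v \<in> {..<n}" using assms by simp
  thus ?thesis unfolding vertices by blast
qed

lemmas distinct_vertices =
  center_not_end center_not_leg(1) end_not_leg(1) center_not_leg(2) end_not_leg(2) legs_disjoint inj_leg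
lemmas nbrs_at = nbrs_center nbrs_end nbrs_leg

lemma finite_legs: "finite H"
  by (rule finite_subset[of H "{..<n}"]) (auto dest: vertex_less(3))

lemma card_vertices: "n = 2 * card H + 2"
proof -
  have c: "c \<notin> insert e (H \<union> g ` H)" and e: "e \<notin> H \<union> g ` H"
    using distinct_vertices by auto
  have d: "H \<inter> g ` H = {}" using legs_disjoint by blast
  have fin: "finite (H \<union> g ` H)" using finite_legs by blast
  have "card {..<n} = Suc (Suc (card (H \<union> g ` H)))"
    unfolding vertices using c e fin by (simp del: insert_iff Un_iff)
  also have "card (H \<union> g ` H) = card H + card (g ` H)"
    by (rule card_Un_disjoint) (use finite_legs d in blast)+
  also have "card (g ` H) = card H" by (rule card_image) (rule distinct_vertices)
  finally show ?thesis by simp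
qed

lemma leg_values:
  assumes "lap_eigenfun n E \<mu> x" "h \<in> H"
  shows "x h = (1 - \<mu>) * x (g h)" "x c = (\<mu>\<^sup>2 - 3 * \<mu> + 1) * x (g h)"
  using lap_eigenfun_pendant_path[OF assms(1) vertex_less(3,4) distinct_vertices(4)
      nbrs_at(3,4), OF assms(2,2,2,2,2)] by blast+

lemma eigenfun_zero:
  assumes x: "lap_eigenfun n E \<mu> x" and 1: "\<mu> \<noteq> 1" and c: "x c = 0"
    and g: "\<And>h. h \<in> H \<Longrightarrow> x (g h) = 0" and v: "v < n"
  shows "x v = 0"
  using vertex_cases[OF v]
proof (elim disjE)
  assume "v = e"
  thus ?thesis using lap_eigenfun_leaf_zero[OF x v _ c 1] nbrs_at(2) by simp
qed (use c g leg_values[OF x] in auto)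

text \<open>With a nonzero quadratic, \<open>x c = 0\<close> kills every leg. This serves for the
  simplicity of the eigenvalue 0.\<close>

lemma center_determining:
  assumes "\<mu>\<^sup>2 - 3 * \<mu> + 1 \<noteq> 0" "\<mu> \<noteq> 1"
  shows "lap_determining n E \<mu> {c}"
proof (rule lap_determiningI)
  fix x v assume x: "lap_eigenfun n E \<mu> x" "\<And>s. s \<in> {c} \<Longrightarrow> x s = 0" and v: "v < n"
  have "x (g h) = 0" if "h \<in> H" for h
    using leg_values(2)[OF x(1) that] x(2)[of c] assms by auto
  thus "x v = 0" using eigenfun_zero[OF x(1) assms(2) _ _ v] x(2) by auto
qed

text \<open>Any one leg forces \<open>x c = 0\<close>, hence \<open>x e = 0\<close>. The equation at
  \<open>c\<close> then makes the values on \<open>H\<close> sum to zero, so one leg may be left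
  out.\<close>

lemma golden_mult_le:
  assumes sg: "simple_graph n E" and \<mu>: "\<mu>\<^sup>2 - 3 * \<mu> + 1 = 0" and H: "H \<noteq> {}"
  shows "lap_mult n E \<mu> \<le> card H - 1"
proof -
  obtain h0 where h0: "h0 \<in> H" using H by auto
  have 1: "\<mu> \<noteq> 1" using \<mu> by auto
  have "lap_determining n E \<mu> (H - {h0})"
  proof (rule lap_determiningI)
    fix x v assume x: "lap_eigenfun n E \<mu> x" "\<And>s. s \<in> H - {h0} \<Longrightarrow> x s = 0" and v: "v < n"
    have c: "x c = 0" using leg_values(2)[OF x(1) h0] \<mu> by simp
    have e: "x e = 0"
      by (rule lap_eigenfun_leaf_zero[OF x(1) _ _ c 1]) (use nbrs_at vertex_less in auto)
    have "x h0 = 0"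
      by (rule lap_eigenfun_nbr_zero[OF x(1) _ c])
         (use vertex_less(1) h0 e x(2) in \<open>auto simp: nbrs_at(1)\<close>)
    hence "x h = 0" if "h \<in> H" for h using x(2)[of h] that by auto
    hence "x (g h) = 0" if "h \<in> H" for h using leg_values(1)[OF x(1) that] 1 that by auto
    thus "x v = 0" using eigenfun_zero[OF x(1) 1 c _ v] by auto
  qed
  moreover have "H - {h0} \<subseteq> {..<n}" using vertex_less(3) by auto
  ultimately have "lap_mult n E \<mu> \<le> card (H - {h0})" by (intro lap_mult_le sg)
  thus ?thesis using h0 by simp
qed

text \<open>The values \<open>1 - \<mu>\<close> and 1 on one leg solve the equations along that leg
  with zero at \<open>c\<close>; subtracting the same on a second leg balances the equation at
  \<open>c\<close>.\<close>

lemma leg_difference_eigenfun: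
  assumes \<mu>: "\<mu>\<^sup>2 - 3 * \<mu> + 1 = 0" and ij: "i \<in> H" "j \<in> H" "i \<noteq> j"
  defines "x \<equiv> \<lambda>v. if v = i then 1 - \<mu> else if v = g i then 1
     else if v = j then \<mu> - 1 else if v = g j then -1 else 0"
  shows "lap_eigenfun n E \<mu> x"
  unfolding lap_eigenfun_def
proof (intro allI impI)
  fix v assume v: "v < n"
  have gg: "g a = g b \<longleftrightarrow> a = b" if "a \<in> H" "b \<in> H" for a b
    using distinct_vertices(7) that by (auto dest: inj_onD)
  have ne: "a \<noteq> g b" "g b \<noteq> a" if "a \<in> H" "b \<in> H" for a b
    using distinct_vertices(6) that by metis+
  have xc: "x c = 0" and xe: "x e = 0"
    using ij distinct_vertices by (auto simp: x_def)
  have q: "\<mu>\<^sup>2 = 3 * \<mu> - 1" using \<mu> by simp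
  have leg: "x h = (1 - \<mu>) * x (g h)" if "h \<in> H" for h
    unfolding x_def using ij ne that gg by auto
  show "real (card (nbrs n E v)) * x v - sum x (nbrs n E v) = \<mu> * x v"
    using vertex_cases[OF v]
  proof (elim disjE)
    assume [simp]: "v = c"
    have "sum x H = sum x {i, j}"
      by (rule sum.mono_neutral_right) (use finite_legs ij ne in \<open>auto simp: x_def\<close>)
    also have "\<dots> = 0" using ij ne by (auto simp: x_def)
    finally show ?thesis
      using xc xe distinct_vertices finite_legs by (simp add: nbrs_at(1))
  next
    assume "v = e"
    thus ?thesis using xc xe by (simp add: nbrs_at(2))
  next
    assume h: "v \<in> H"
    have "2 * x v - x (g v) = \<mu> * x v"
    proof -
      have "2 * x v - x (g v) - \<mu> * x v = (1 - 3 * \<mu> + \<mu>\<^sup>2) * x (g v)"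
        unfolding leg[OF h] by (simp add: algebra_simps power2_eq_square)
      thus ?thesis using q by simp
    qed
    thus ?thesis using nbrs_at(3)[OF h] distinct_vertices(4)[OF h] xc by simp
  next
    assume "v \<in> g ` H"
    then obtain h where h: "h \<in> H" "v = g h" by auto
    show ?thesis using nbrs_at(4)[OF h(1)] leg[OF h(1)] h(2) by (simp add: algebra_simps)
  qed
qed

text \<open>A determining set meets all legs but at most one, since two missed legs would support
  the difference eigenfunction.\<close>

lemma golden_mult_ge:
  assumes sg: "simple_graph n E" and \<mu>: "\<mu>\<^sup>2 - 3 * \<mu> + 1 = 0"
  shows "card H - 1 \<le> lap_mult n E \<mu>"
proof (rule lap_mult_ge[OF sg])
  fix S assume S: "S \<subseteq> {..<n}" and d: "lap_determining n E \<mu> S"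
  have finS: "finite S" using S finite_subset by blast
  define U where "U = {h \<in> H. h \<notin> S \<and> g h \<notin> S}"
  have "i = j" if ij: "i \<in> U" "j \<in> U" for i j
  proof (rule ccontr)
    assume ne: "i \<noteq> j"
    let ?x = "\<lambda>v. if v = i then 1 - \<mu> else if v = g i then 1
      else if v = j then \<mu> - 1 else if v = g j then -1 else 0"
    have "lap_eigenfun n E \<mu> ?x"
      using ij ne by (intro leg_difference_eigenfun \<mu>) (auto simp: U_def)
    moreover have "\<forall>s\<in>S. ?x s = 0" using ij by (auto simp: U_def)
    ultimately have "?x (g i) = 0"
      using d vertex_less(4)[of i] ij unfolding lap_determining_def U_def by blast
    moreover have "g i \<noteq> i" using distinct_vertices(6)[of i i] ij by (auto simp: U_def)
    ultimately show False by simp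
  qed
  hence U1: "card U \<le> 1" using finite_legs by (auto simp: U_def card_le_Suc0_iff_eq)
  \<comment> \<open>Each leg that is met contributes a vertex of \<open>S\<close>, and different
    legs are disjoint.\<close>
  have "inj_on (\<lambda>h. if h \<in> S then h else g h) (H - U)"
  proof (rule inj_onI)
    fix a b assume "a \<in> H - U" "b \<in> H - U" "(if a \<in> S then a else g a) = (if b \<in> S then b else g b)"
    thus "a = b" using distinct_vertices(6)[of a b] distinct_vertices(6)[of b a]
        inj_onD[OF distinct_vertices(7), of a b] by (auto split: if_splits)
  qed
  moreover have "(\<lambda>h. if h \<in> S then h else g h) ` (H - U) \<subseteq> S" by (auto simp: U_def)
  ultimately have "card (H - U) \<le> card S" using finS by (rule card_inj_on_le)
  moreover have "card (H - U) = card H - card U"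
    by (rule card_Diff_subset) (use finite_legs in \<open>auto simp: U_def\<close>)
  ultimately show "card H - 1 \<le> card S" using U1 by linarith
qed

lemma golden_mult:
  assumes "simple_graph n E" "\<mu>\<^sup>2 - 3 * \<mu> + 1 = 0" "H \<noteq> {}"
  shows "lap_mult n E \<mu> = card H - 1"
  using golden_mult_le[OF assms] golden_mult_ge[OF assms(1,2)] by simp

section \<open>The algebraic connectivity of the spider\<close>

text \<open>Below the smaller golden root both \<open>1 - \<nu>\<close> and the quadratic are
  positive, so all values can be expressed through \<open>x c\<close>. The equation at
  \<open>c\<close> becomes \<nu> times a positive number times \<open>x c\<close> equals
  zero.\<close>

lemma no_small_eigenvalue:
  assumes sg: "simple_graph n E" and l: "\<nu> < (3 - sqrt 5) / 2" "\<nu> \<noteq> 0"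
  shows "lap_mult n E \<nu> = 0"
proof -
  have s5: "2 < sqrt 5" by (rule real_less_rsqrt) simp
  have l1: "\<nu> < 1" using l(1) s5 by simp
  define p where "p = \<nu>\<^sup>2 - 3 * \<nu> + 1"
  have "p = ((3 - sqrt 5) / 2 - \<nu>) * ((3 + sqrt 5) / 2 - \<nu>)"
    unfolding p_def by (simp add: field_simps power2_eq_square)
  also have "\<dots> > 0" by (rule mult_pos_pos) (use l s5 in simp_all)
  finally have p: "p > 0" .
  have "lap_determining n E \<nu> {}"
  proof (rule lap_determiningI)
    fix x v assume x: "lap_eigenfun n E \<nu> x" and v: "v < n"
    have e: "x e = x c / (1 - \<nu>)"
      using lap_eigenfun_leaf[OF x vertex_less(2) nbrs_at(2)] l1 by simp
    have w: "x (g h) = x c / p" if "h \<in> H" for h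
      using leg_values(2)[OF x that] p by (simp add: p_def field_simps)
    have u: "x h = (1 - \<nu>) * x c / p" if "h \<in> H" for h
      using leg_values(1)[OF x that] w[OF that] by simp
    have "sum x H = real (card H) * ((1 - \<nu>) * x c / p)" using u by simp
    moreover have "x e + sum x H = (real (card H) + 1 - \<nu>) * x c"
      using lap_eigenfunD[OF x vertex_less(1)] distinct_vertices(3) finite_legs
      by (simp add: nbrs_at(1) algebra_simps)
    ultimately have "x c / (1 - \<nu>) + real (card H) * ((1 - \<nu>) * x c / p) = (real (card H) + 1 - \<nu>) * x c"
      using e by simp
    \<comment> \<open>Chosen to split off a factor \<nu>: since
      \<open>1 - \<nu> = p + \<nu> * (2 - \<nu>)\<close>, the quotient by \<open>p\<close> is
      \<open>1 + \<nu> * t\<close>. Likewise \<open>r\<close> gives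
      \<open>1 / (1 - \<nu>) = 1 + \<nu> * r\<close>, and the terms without \<nu> cancel.\<close>
    moreover define t where "t = (2 - \<nu>) / p"
    moreover have "(1 - \<nu>) * x c / p = x c + \<nu> * t * x c"
      unfolding t_def using p by (simp add: p_def field_simps power2_eq_square)
    moreover define r where "r = 1 / (1 - \<nu>)"
    moreover have "x c / (1 - \<nu>) = x c + \<nu> * r * x c"
      unfolding r_def using l1 by (simp add: field_simps)
    ultimately have "x c + \<nu> * r * x c + real (card H) * (x c + \<nu> * t * x c)
        = (real (card H) + 1 - \<nu>) * x c" by simp
    hence "\<nu> * (r + real (card H) * t + 1) * x c = 0"
      by (simp add: algebra_simps)
    moreover have "r + real (card H) * t + 1 > 0"
      unfolding r_def t_def using l1 p by (intro add_nonneg_pos add_nonneg_nonneg) auto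
    ultimately have c: "x c = 0" using l(2) by simp
    show "x v = 0"
      by (rule eigenfun_zero[OF x _ c _ v]) (use w c l1 in auto)
  qed
  thus ?thesis using lap_mult_le[OF sg, of "{}"] by simp
qed

text \<open>The constant function rules out an empty determining set, and at 0 the quadratic is 1,
  so the centre alone determines.\<close>

lemma mult_zero:
  assumes sg: "simple_graph n E"
  shows "lap_mult n E 0 = 1"
proof (rule antisym)
  show "lap_mult n E 0 \<le> 1"
    using lap_mult_le[OF sg, of "{c}"] center_determining[of 0] vertex_less(1) by simp
  show "1 \<le> lap_mult n E 0"
  proof (rule lap_mult_ge[OF sg])
    fix S assume S: "S \<subseteq> {..<n}" "lap_determining n E 0 S"
    have "lap_eigenfun n E 0 (\<lambda>_. 1)" by (simp add: lap_eigenfun_def)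
    hence "S \<noteq> {}" using S(2) vertex_less(1) unfolding lap_determining_def by force
    thus "1 \<le> card S" using S(1) finite_subset[of S] by (simp add: Suc_le_eq card_gt_0_iff)
  qed
qed

text \<open>Entry 0 of the sorted spectrum is the simple eigenvalue 0. The smaller golden root
  occurs, with multiplicity at least \<open>card H - 1\<close>, and no other nonzero eigenvalue lies
  below it, so it is entry 1.\<close>

lemma alg_conn_eq:
  assumes sg: "simple_graph n E" and H: "card H \<ge> 2"
  shows "alg_conn n E = (3 - sqrt 5) / 2"
proof -
  let ?\<alpha> = "(3 - sqrt 5) / 2"
  have s5: "sqrt 5 < 3" by (rule real_less_lsqrt) simp_all
  define M where "M = proots (char_poly (laplacian n E :: real mat))"
  have "char_poly (laplacian n E :: real mat) \<noteq> 0"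
    using degree_monic_char_poly[OF laplacian_carrier[of n E, where 'a=real]] by auto
  hence count: "count M x = lap_mult n E x" for x
    unfolding M_def lap_mult_def by simp
  have root: "?\<alpha>\<^sup>2 - 3 * ?\<alpha> + 1 = 0" by (simp add: field_simps power2_eq_square)
  have "lap_mult n E ?\<alpha> > 0" using golden_mult_ge[OF sg root] H by simp
  hence \<alpha>M: "?\<alpha> \<in># M" using count by (metis count_greater_zero_iff)
  define N where "N = M - {#0#}"
  have M: "M = add_mset 0 N"
    using count[of 0] mult_zero[OF sg] unfolding N_def by (simp add: count_greater_zero_iff[symmetric] del: count_greater_zero_iff)
  have N0: "0 \<notin># N" using count[of 0] mult_zero[OF sg] unfolding M by (simp add: not_in_iff)
  have \<alpha>N: "?\<alpha> \<in># N" using \<alpha>M s5 unfolding M by auto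
  have least: "?\<alpha> \<le> y" if "y \<in># N" for y
  proof (rule ccontr)
    assume "\<not> ?\<alpha> \<le> y"
    hence "lap_mult n E y = 0" using that N0 by (intro no_small_eigenvalue sg) auto
    hence "y \<notin># M" using count[of y] by (simp add: not_in_iff)
    thus False using that M by simp
  qed
  obtain y ys where ys: "sorted_list_of_multiset N = y # ys"
    using \<alpha>N by (cases "sorted_list_of_multiset N") (metis empty_iff set_mset_empty set_sorted_list_of_multiset list.set(1), blast)
  have "y \<in># N" using ys set_sorted_list_of_multiset[of N] by auto
  moreover have "y \<le> ?\<alpha>"
  proof -
    have "?\<alpha> \<in> insert y (set ys)" using \<alpha>N set_sorted_list_of_multiset[of N] unfolding ys by simp
    moreover have "\<forall>z\<in>set ys. y \<le> z" using sorted_sorted_list_of_multiset[of N] unfolding ys by simp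
    ultimately show ?thesis by blast
  qed
  ultimately have "y = ?\<alpha>" using least by force
  moreover have "0 \<le> ?\<alpha>" using s5 by simp
  ultimately have "sorted_list_of_multiset M = 0 # ?\<alpha> # ys" unfolding M by (simp add: ys)
  thus ?thesis unfolding alg_conn_def lap_spectrum_def M_def[symmetric] by simp
qed

end

section \<open>Conjugacy of the golden eigenvalues over the rationals\<close>

text \<open>A proper factor would be linear and give a root \<open>a / b\<close> in lowest terms.
  Then \<open>a * a - 3 * a * b + b * b\<close> is zero, hence even, which makes both
  \<open>a\<close> and \<open>b\<close> even.\<close>

lemma irreducible_golden_poly: "irreducible [:1, -3, 1 :: rat:]"
proof -
  have no_root: "poly [:1, -3, 1:] r \<noteq> 0" for r :: rat
  proof
    assume r: "poly [:1, -3, 1:] r = 0"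
    obtain a b where ab: "quotient_of r = (a, b)" by fastforce
    have b: "b > 0" "coprime a b" "r = of_int a / of_int b"
      using ab quotient_of_denom_pos quotient_of_coprime quotient_of_div by auto
    have "(of_int (a * a - 3 * a * b + b * b) :: rat) = 0"
      using r b by (simp add: field_simps power2_eq_square)
    hence eq: "a * a - 3 * a * b + b * b = 0" using of_int_eq_0_iff by blast
    hence "even (a * a - 3 * a * b + b * b)" by simp
    hence "even a \<and> even b" by auto
    hence "2 dvd gcd a b" by simp
    thus False using b(2) by simp
  qed
  show ?thesis
  proof (rule irreducibleI)
    show "\<not> [:1, -3, 1 :: rat:] dvd 1" by (simp add: is_unit_iff_degree)
    fix a b :: "rat poly" assume ab: "[:1, -3, 1:] = a * b"
    have nz: "a \<noteq> 0" "b \<noteq> 0" using ab by auto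
    have deg: "degree a + degree b = 2" using arg_cong[OF ab, of degree] nz by (simp add: degree_mult_eq)
    have lin: "degree q \<noteq> 1" if q: "q dvd [:1, -3, 1:]" for q :: "rat poly"
    proof
      assume "degree q = 1"
      then obtain u v where uv: "q = [:u, v:]" "v \<noteq> 0"
        by (metis degree1_coeffs)
      hence "poly q (- u / v) = 0" by simp
      moreover obtain k where "[:1, -3, 1:] = q * k" using q by (elim dvdE)
      ultimately have "poly [:1, -3, 1:] (- u / v) = 0" by (metis mult_zero_left poly_mult)
      thus False using no_root by blast
    qed
    have "degree a \<noteq> 1" using lin[of a] ab by simp
    hence "degree a = 0 \<or> degree b = 0" using deg by linarith
    thus "a dvd 1 \<or> b dvd 1" using nz by (simp add: is_unit_iff_degree)
  qed simp
qed

text \<open>Otherwise \<open>p\<close> and \<open>q\<close> are coprime, and a Bezout identity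
  evaluated at the common root reads 0 = 1.\<close>

lemma irreducible_dvd_common_root:
  fixes p q :: "rat poly" and a :: real
  assumes p: "irreducible p" and "poly (map_poly of_rat p) a = 0" "poly (map_poly of_rat q) a = 0"
  shows "p dvd q"
proof (rule ccontr)
  assume "\<not> p dvd q"
  interpret hom: map_poly_comm_ring_hom "of_rat :: rat \<Rightarrow> real" ..
  have "coprime p q" using \<open>\<not> p dvd q\<close> by (rule prime_elem_imp_coprime[OF field_poly_irreducible_imp_prime[OF p]])
  then obtain u v where "u * p + v * q = 1" by (metis bezout_coefficients_fst_snd coprime_iff_gcd_eq_1)
  hence "poly (map_poly (of_rat :: rat \<Rightarrow> real) (u * p + v * q)) a = 1" by simp
  hence "poly (map_poly (of_rat :: rat \<Rightarrow> real) u * map_poly of_rat p + map_poly of_rat v * map_poly of_rat q) a = 1"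
    by (simp only: hom.hom_add hom.hom_mult)
  thus False using assms by simp
qed

text \<open>The witness is the golden quadratic. It divides the rational characteristic polynomial
  because it is irreducible and shares the real root \<open>a\<close> with it.\<close>

lemma lap_conjugates_golden:
  assumes a: "a\<^sup>2 - 3 * a + 1 = 0" "lap_mult n E a > 0" and b: "b\<^sup>2 - 3 * b + 1 = 0"
  shows "lap_conjugates n E a b"
  unfolding lap_conjugates_def
proof (intro exI conjI)
  let ?L = "laplacian n E :: rat mat"
  have L: "map_mat of_rat ?L = (laplacian n E :: real mat)"
    by (rule eq_matI) (auto simp: laplacian_def)
  have root: "poly (map_poly of_rat [:1, -3, 1:]) x = x\<^sup>2 - 3 * x + 1" for x :: real
    by (simp add: map_poly_pCons power2_eq_square algebra_simps)
  show "irreducible [:1, -3, 1 :: rat:]" by (rule irreducible_golden_poly)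
  show "poly (map_poly of_rat [:1, -3, 1:]) a = 0" "poly (map_poly of_rat [:1, -3, 1:]) b = 0"
    using a b root by simp_all
  have "poly (char_poly (laplacian n E :: real mat)) a = 0"
    using a(2) unfolding lap_mult_def by (metis less_numeral_extra(3) order_0I)
  also have "char_poly (laplacian n E :: real mat) = map_poly of_rat (char_poly ?L)"
    unfolding L[symmetric] by (rule of_rat_hom.char_poly_hom[OF laplacian_carrier])
  finally show "[:1, -3, 1:] dvd char_poly ?L"
    using a root by (intro irreducible_dvd_common_root[OF irreducible_golden_poly, of a]) simp_all
qed

section \<open>Isomorphism with the spider\<close>

text \<open>Running the bijection backwards and comparing neighbour sets matches the form of the
  assumptions of \<open>spider_at\<close>.\<close>

lemma graph_iso_nbrs_iff:
  "graph_iso n E n' E' \<longleftrightarrow>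
     (\<exists>\<phi>. bij_betw \<phi> {..<n'} {..<n} \<and> (\<forall>a<n'. nbrs n E (\<phi> a) = \<phi> ` nbrs n' E' a))"
proof
  assume "graph_iso n E n' E'"
  then obtain f where f: "bij_betw f {..<n} {..<n'}" "\<forall>i<n. \<forall>j<n. E i j \<longleftrightarrow> E' (f i) (f j)"
    unfolding graph_iso_def by blast
  define \<phi> where "\<phi> = inv_into {..<n} f"
  have \<phi>: "bij_betw \<phi> {..<n'} {..<n}" unfolding \<phi>_def by (rule bij_betw_inv_into[OF f(1)])
  have \<phi>n: "\<phi> a < n" and f\<phi>: "f (\<phi> a) = a" if "a < n'" for a
    using \<phi> that bij_betw_inv_into_right[OF f(1), of a] by (auto simp: \<phi>_def bij_betw_def)
  have "nbrs n E (\<phi> a) = \<phi> ` nbrs n' E' a" if a: "a < n'" for a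
  proof (rule Set.set_eqI)
    fix v
    have "v \<in> nbrs n E (\<phi> a) \<longleftrightarrow> (\<exists>b<n'. v = \<phi> b \<and> E (\<phi> a) (\<phi> b))"
      using \<phi> \<phi>n unfolding bij_betw_def by (metis (mono_tags, lifting) imageE lessThan_iff mem_Collect_eq)
    also have "\<dots> \<longleftrightarrow> v \<in> \<phi> ` nbrs n' E' a"
      using f(2) \<phi>n f\<phi> a by auto
    finally show "v \<in> nbrs n E (\<phi> a) \<longleftrightarrow> v \<in> \<phi> ` nbrs n' E' a" .
  qed
  thus "\<exists>\<phi>. bij_betw \<phi> {..<n'} {..<n} \<and> (\<forall>a<n'. nbrs n E (\<phi> a) = \<phi> ` nbrs n' E' a)"
    using \<phi> by blast
next
  assume "\<exists>\<phi>. bij_betw \<phi> {..<n'} {..<n} \<and> (\<forall>a<n'. nbrs n E (\<phi> a) = \<phi> ` nbrs n' E' a)"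
  then obtain \<phi> where \<phi>: "bij_betw \<phi> {..<n'} {..<n}" "\<And>a. a < n' \<Longrightarrow> nbrs n E (\<phi> a) = \<phi> ` nbrs n' E' a"
    by blast
  define f where "f = inv_into {..<n'} \<phi>"
  have f: "bij_betw f {..<n} {..<n'}" unfolding f_def by (rule bij_betw_inv_into[OF \<phi>(1)])
  have fn: "f i < n'" and \<phi>f: "\<phi> (f i) = i" if "i < n" for i
    using f that bij_betw_inv_into_right[OF \<phi>(1), of i] by (auto simp: f_def bij_betw_def)
  have "E i j \<longleftrightarrow> E' (f i) (f j)" if ij: "i < n" "j < n" for i j
  proof -
    have "E i j \<longleftrightarrow> \<phi> (f j) \<in> \<phi> ` nbrs n' E' (f i)"
      unfolding \<phi>(2)[OF fn[OF ij(1)], symmetric] using ij \<phi>f by simp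
    also have "\<dots> \<longleftrightarrow> f j \<in> nbrs n' E' (f i)"
      by (rule inj_on_image_mem_iff[of _ "{..<n'}"]) (use \<phi>(1) fn ij in \<open>auto simp: bij_betw_def\<close>)
    finally show ?thesis using fn[OF ij(2)] by simp
  qed
  thus "graph_iso n E n' E'" using f unfolding graph_iso_def by blast
qed

text \<open>In \<open>T(k+1,k)\<close> only the ray \<open>Suc k\<close> is short: it plays the part
  of \<open>e\<close>, the rays 1 to \<open>k\<close> form \<open>H\<close>, and adding
  \<open>Suc k\<close> is the map \<open>g\<close>.\<close>

lemma spider_adj_nbrs:
  "nbrs (Suc k + k + 1) (spider_adj (Suc k) k) 0 = insert (Suc k) {1..k}"
  "nbrs (Suc k + k + 1) (spider_adj (Suc k) k) (Suc k) = {0}"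
  "a \<in> {1..k} \<Longrightarrow> nbrs (Suc k + k + 1) (spider_adj (Suc k) k) a = {0, Suc k + a}"
  "a \<in> {1..k} \<Longrightarrow> nbrs (Suc k + k + 1) (spider_adj (Suc k) k) (Suc k + a) = {a}"
  by (auto simp: spider_adj_def)

lemma spider_vertices:
  "{..<Suc k + k + 1} = insert 0 (insert (Suc k) ({1..k} \<union> (+) (Suc k) ` {1..k}))"
proof (rule Set.set_eqI)
  fix v
  have "v \<in> (+) (Suc k) ` {1..k}" if "v > Suc k" "v < Suc k + k + 1"
    using that by (intro image_eqI[of _ _ "v - Suc k"]) auto
  thus "v \<in> {..<Suc k + k + 1} \<longleftrightarrow> v \<in> insert 0 (insert (Suc k) ({1..k} \<union> (+) (Suc k) ` {1..k}))"
    by (cases "v > Suc k") auto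
qed

lemma spider_at_if_iso:
  assumes "graph_iso n E (Suc k + k + 1) (spider_adj (Suc k) k)"
  obtains c e H g where "spider_at n E c e H g" "card H = k"
proof -
  let ?n = "Suc k + k + 1"
  obtain \<phi> where \<phi>: "bij_betw \<phi> {..<?n} {..<n}"
    "\<And>a. a < ?n \<Longrightarrow> nbrs n E (\<phi> a) = \<phi> ` nbrs ?n (spider_adj (Suc k) k) a"
    using assms unfolding graph_iso_nbrs_iff by blast
  have inj: "\<phi> a = \<phi> b \<longleftrightarrow> a = b" if "a < ?n" "b < ?n" for a b
    using \<phi>(1) that unfolding bij_betw_def by (auto dest: inj_onD)
  have injk: "inj_on \<phi> {1..k}" by (auto intro!: inj_onI simp: inj)
  \<comment> \<open>The shift by \<open>Suc k\<close> on labels, transported to the vertices of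
    \<open>E\<close> along the bijection.\<close>
  define g where "g h = \<phi> (Suc k + inv_into {1..k} \<phi> h)" for h
  have g: "g (\<phi> a) = \<phi> (Suc k + a)" if "a \<in> {1..k}" for a
    unfolding g_def using inv_into_f_f[OF injk that] by simp
  have gH: "g ` \<phi> ` {1..k} = \<phi> ` (+) (Suc k) ` {1..k}"
    unfolding image_image by (rule image_cong) (use g in auto)
  have "spider_at n E (\<phi> 0) (\<phi> (Suc k)) (\<phi> ` {1..k}) g"
  proof
    have "{..<n} = \<phi> ` {..<?n}" using \<phi>(1) by (simp add: bij_betw_def)
    thus "{..<n} = insert (\<phi> 0) (insert (\<phi> (Suc k)) (\<phi> ` {1..k} \<union> g ` \<phi> ` {1..k}))"
      unfolding gH spider_vertices image_insert image_Un .
    show "inj_on g (\<phi> ` {1..k})" by (auto intro!: inj_onI simp: g inj)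
    show "nbrs n E (\<phi> 0) = insert (\<phi> (Suc k)) (\<phi> ` {1..k})"
      "nbrs n E (\<phi> (Suc k)) = {\<phi> 0}"
      by (simp_all only: \<phi>(2) spider_adj_nbrs image_insert image_empty)
    fix h assume "h \<in> \<phi> ` {1..k}"
    then obtain a where a: "a \<in> {1..k}" "h = \<phi> a" by blast
    show "nbrs n E h = {\<phi> 0, g h}" "nbrs n E (g h) = {h}"
      unfolding a(2) g[OF a(1)] using \<phi>(2)[of a] \<phi>(2)[of "Suc k + a"] a(1)
      unfolding spider_adj_nbrs(3,4)[OF a(1)] by auto
    show "\<phi> 0 \<noteq> g h" "\<phi> (Suc k) \<noteq> g h" unfolding a(2) g[OF a(1)] using a(1) by (simp_all add: inj)
    show "h' \<noteq> g h" if "h' \<in> \<phi> ` {1..k}" for h'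
      unfolding a(2) g[OF a(1)] using that a(1) by (auto simp: inj)
  qed (auto simp: inj)
  moreover have "card (\<phi> ` {1..k}) = k" using card_image[OF injk] by simp
  ultimately show ?thesis using that by blast
qed

lemma (in spider_at) iso_spider:
  assumes k: "card H = k"
  shows "graph_iso n E (Suc k + k + 1) (spider_adj (Suc k) k)"
proof -
  let ?n = "Suc k + k + 1"
  obtain ix where ix: "bij_betw ix {1..k} H"
    using ex_bij_betw_nat_finite_1[OF finite_legs] k by auto
  define \<phi> where "\<phi> a = (if a = 0 then c else if a \<le> k then ix a else if a = Suc k then e
     else g (ix (a - Suc k)))" for a
  have \<phi>: "\<phi> 0 = c" "\<phi> (Suc k) = e" "\<And>a. a \<in> {1..k} \<Longrightarrow> \<phi> a = ix a"
    "\<And>a. a \<in> {1..k} \<Longrightarrow> \<phi> (Suc k + a) = g (ix a)"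
    by (auto simp: \<phi>_def)
  have ixH: "ix a \<in> H" if "a \<in> {1..k}" for a using ix that by (auto simp: bij_betw_def)
  have H: "\<phi> ` {1..k} = H"
  proof -
    have "\<phi> ` {1..k} = ix ` {1..k}" by (rule image_cong) (use \<phi>(3) in auto)
    thus ?thesis using ix by (simp add: bij_betw_def)
  qed
  have gH: "\<phi> ` (+) (Suc k) ` {1..k} = g ` H"
  proof -
    have "\<phi> ` (+) (Suc k) ` {1..k} = (\<lambda>a. g (ix a)) ` {1..k}"
      unfolding image_image by (rule image_cong) (use \<phi>(4) in auto)
    also have "\<dots> = g ` ix ` {1..k}" unfolding image_image ..
    also have "ix ` {1..k} = H" using ix by (simp add: bij_betw_def)
    finally show ?thesis .
  qed
  have img: "\<phi> ` {..<?n} = {..<n}"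
    unfolding spider_vertices image_insert image_Un H gH \<phi>(1,2) vertices ..
  \<comment> \<open>Injectivity comes from counting: the image is the whole vertex set, which has
    the size of the domain.\<close>
  have "card (\<phi> ` {..<?n}) = card {..<?n}" unfolding img using card_vertices k by simp
  hence "inj_on \<phi> {..<?n}" by (intro eq_card_imp_inj_on) auto
  hence "bij_betw \<phi> {..<?n} {..<n}" using img by (simp add: bij_betw_def)
  moreover have "nbrs n E (\<phi> a) = \<phi> ` nbrs ?n (spider_adj (Suc k) k) a" if "a < ?n" for a
  proof -
    have "a \<in> insert 0 (insert (Suc k) ({1..k} \<union> (+) (Suc k) ` {1..k}))"
      using that unfolding spider_vertices[symmetric] by simp
    then consider "a = 0" | "a = Suc k" | "a \<in> {1..k}" | b where "b \<in> {1..k}" "a = Suc k + b"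
      by blast
    thus ?thesis
    proof cases
      case 3
      thus ?thesis unfolding spider_adj_nbrs(3)[OF 3]
        using \<phi> ixH[OF 3] nbrs_leg by simp
    next
      case 4
      thus ?thesis unfolding 4(2) spider_adj_nbrs(4)[OF 4(1)]
        using \<phi> ixH[OF 4(1)] nbrs_leg by simp
    qed (simp_all only: spider_adj_nbrs \<phi> nbrs_center nbrs_end image_insert image_empty H)
  qed
  ultimately show ?thesis unfolding graph_iso_nbrs_iff by blast
qed

section \<open>Trees with a large multiplicity\<close>

text \<open>By \<open>tree_star_or_inner\<close>, every tree that is not a star can be rooted so
  that the root has a twig \<open>p\<close> as a child.\<close>

locale rooted_tree_inner = rooted_tree +
  fixes p :: nat
  assumes inner_less: "p < n" and inner_nonroot: "p \<noteq> r" and par_inner: "par p = r"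
    and inner_children: "children p \<noteq> {}" "w \<in> children p \<Longrightarrow> children w = {}"
begin

definition twigs :: "nat set" where
  "twigs = {v. v < n \<and> v \<noteq> r \<and> children v \<noteq> {} \<and> (\<forall>w\<in>children v. children w = {})}"

lemma inner_in_twigs: "p \<in> twigs"
  using inner_less inner_nonroot inner_children by (simp add: twigs_def)

lemma twigs_finite: "finite twigs"
  by (simp add: twigs_def)

text \<open>A vertex \<open>v\<close> that is no twig has a child \<open>w\<close> with children.
  Below \<open>w\<close> everything needed vanishes already, so the equation at \<open>w\<close>
  isolates its parent \<open>v\<close>. As \<open>p\<close> hangs at the root, it never occurs below
  a non-root vertex.\<close>

lemma twigs_propagate:
  assumes x: "lap_eigenfun n E \<mu> x" and 1: "\<mu> \<noteq> 1" and z: "\<And>h. h \<in> twigs - {p} \<Longrightarrow> x h = 0"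
    and v: "v < n" "v \<noteq> r" "v \<noteq> p" "children v \<noteq> {}"
  shows "x v = 0"
  using v
\<comment> \<open>The measure decreases with depth, so deeper vertices are settled first.\<close>
proof (induction "Max (d ` {..<n}) - d v" arbitrary: v rule: less_induct)
  case less
  have IH: "x w = 0" if w: "w < n" "w \<noteq> r" "w \<noteq> p" "children w \<noteq> {}" "d v < d w" for w
  proof (rule less.hyps)
    have "d w \<le> Max (d ` {..<n})" by (rule Max_ge) (use w in auto)
    thus "Max (d ` {..<n}) - d w < Max (d ` {..<n}) - d v" using w(5) by linarith
  qed (use w in auto)
  show ?case
  proof (cases "v \<in> twigs")
    case True
    thus ?thesis using z less.prems by blast
  next
    case False
    then obtain w where w: "w \<in> children v" "children w \<noteq> {}"
      using less.prems by (auto simp: twigs_def)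
    note wD = childrenD[OF w(1)]
    have wp: "w \<noteq> p" using wD(3) par_inner less.prems by auto
    have xw: "x w = 0" using IH wD wp w(2) by simp
    show ?thesis
    proof (rule lap_eigenfun_nbr_zero[OF x wD(1) xw])
      show "v \<in> nbrs n E w" using nbrs_nonroot[OF wD(1,2)] wD(3) by simp
      fix u assume u: "u \<in> nbrs n E w" "u \<noteq> v"
      hence uw: "u \<in> children w" using nbrs_nonroot[OF wD(1,2)] wD(3) by simp
      note uD = childrenD[OF uw]
      show "x u = 0"
      proof (cases "children u = {}")
        case True
        thus ?thesis using lap_eigenfun_childless_zero[OF x 1 uD(1,2)] uD(3) xw by simp
      next
        case False
        have "u \<noteq> p" using uD(3) par_inner wD(2) by auto
        thus ?thesis using IH[OF uD(1,2) _ False] uD(4) wD(4) by simp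
      qed
    qed
  qed
qed

lemma eigenfun_zero_if_childful_zero:
  assumes x: "lap_eigenfun n E \<mu> x" and 1: "\<mu> \<noteq> 1" and r: "x r = 0"
    and z: "\<And>u. u < n \<Longrightarrow> u \<noteq> r \<Longrightarrow> children u \<noteq> {} \<Longrightarrow> x u = 0" and v: "v < n"
  shows "x v = 0"
proof (cases "v = r \<or> children v \<noteq> {}")
  case True
  thus ?thesis using r z v by blast
next
  case False
  hence vr: "v \<noteq> r" "children v = {}" by auto
  have "children (par v) \<noteq> {}" using in_children_par[OF v vr(1)] by blast
  hence "x (par v) = 0" using r z[OF par_less[OF v vr(1)]] by blast
  thus ?thesis by (rule lap_eigenfun_childless_zero[OF x 1 v vr])
qed

text \<open>The second branching child \<open>q\<close> makes up for the missing \<open>p\<close>: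
  the equation at \<open>q\<close> isolates the root, and the equation at the root then isolates
  \<open>p\<close>.\<close>

lemma twigs_determining:
  assumes 1: "\<mu> \<noteq> 1" and q: "q \<in> children r" "q \<noteq> p" "children q \<noteq> {}"
  shows "lap_determining n E \<mu> (twigs - {p})"
proof (rule lap_determiningI)
  fix x v assume x: "lap_eigenfun n E \<mu> x" and z: "\<And>h. h \<in> twigs - {p} \<Longrightarrow> x h = 0" and v: "v < n"
  note vanish = twigs_propagate[OF x 1 z]
  note qD = childrenD[OF q(1)]
  have xq: "x q = 0" using vanish qD q by simp
  have nq: "nbrs n E q = insert r (children q)" using nbrs_nonroot[OF qD(1,2)] qD(3) by simp
  have xr: "x r = 0"
  proof (rule lap_eigenfun_nbr_zero[OF x qD(1) xq])
    fix u assume "u \<in> nbrs n E q" "u \<noteq> r"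
    hence u: "u \<in> children q" using nq by simp
    have "u \<noteq> p" using childrenD(3)[OF u] par_inner qD(2) by auto
    thus "x u = 0"
      using vanish[of u] lap_eigenfun_childless_zero[OF x 1, of u] childrenD[OF u] xq by blast
  qed (use nq in simp)
  have xp: "x p = 0"
  proof (rule lap_eigenfun_nbr_zero[OF x root_less xr])
    show "p \<in> nbrs n E r"
      unfolding nbrs_root using in_children_par[OF inner_less inner_nonroot] par_inner by simp
    fix u assume "u \<in> nbrs n E r" "u \<noteq> p"
    moreover from this have u: "u \<in> children r" using nbrs_root by simp
    ultimately show "x u = 0"
      using vanish[of u] lap_eigenfun_childless_zero[OF x 1, of u] childrenD[OF u] xr by blast
  qed
  show "x v = 0"
    by (rule eigenfun_zero_if_childful_zero[OF x 1 xr _ v]) (use vanish xp in blast)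
qed

text \<open>Without a second branching child, \<open>p\<close> is the only non-root vertex with
  children, and its equation isolates the root. This case only allows multiplicity at most
  one.\<close>

lemma inner_determining:
  assumes 1: "\<mu> \<noteq> 1" and q: "\<And>q. q \<in> children r \<Longrightarrow> q \<noteq> p \<Longrightarrow> children q = {}"
  shows "lap_determining n E \<mu> {p}"
proof (rule lap_determiningI)
  fix x v assume x: "lap_eigenfun n E \<mu> x" and z: "\<And>h. h \<in> {p} \<Longrightarrow> x h = 0" and v: "v < n"
  have xp: "x p = 0" using z by simp
  \<comment> \<open>If \<open>par u\<close> were not the root, it would be \<open>p\<close> by
    induction on depth, but the children of \<open>p\<close> are leaves.\<close>
  have only: "u = p" if "u < n" "u \<noteq> r" "children u \<noteq> {}" for u
    using that
  proof (induction "d u" arbitrary: u rule: less_induct)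
    case less
    have u: "u \<in> children (par u)" using in_children_par less.prems by blast
    have "par u = r"
    proof (rule ccontr)
      assume ne: "par u \<noteq> r"
      have "par u = p"
        by (rule less.hyps) (use ne u par_less depth_par less.prems in auto)
      thus False using inner_children(2) u less.prems by auto
    qed
    thus ?case using q u less.prems by auto
  qed
  have np: "nbrs n E p = insert r (children p)"
    using nbrs_nonroot[OF inner_less inner_nonroot] par_inner by simp
  have xr: "x r = 0"
  proof (rule lap_eigenfun_nbr_zero[OF x inner_less xp])
    fix u assume "u \<in> nbrs n E p" "u \<noteq> r"
    hence u: "u \<in> children p" using np by simp
    thus "x u = 0"
      using lap_eigenfun_childless_zero[OF x 1] childrenD[OF u] inner_children(2)[OF u] xp by simp
  qed (use np in simp)
  show "x v = 0"
    by (rule eigenfun_zero_if_childful_zero[OF x 1 xr _ v]) (use only xp in blast)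
qed

lemma spider_if_multiplicity:
  assumes sg: "simple_graph n E" and 1: "\<mu> \<noteq> 1"
    and mult: "2 * lap_mult n E \<mu> + 4 = n" and n8: "8 \<le> n"
  obtains e H g where "spider_at n E r e H g" "\<mu>\<^sup>2 - 3 * \<mu> + 1 = 0"
proof -
  have m2: "lap_mult n E \<mu> \<ge> 2" using mult n8 by simp
  have large: "lap_mult n E \<mu> \<le> card S" if "S \<subseteq> {..<n}" "lap_determining n E \<mu> S" for S
    by (rule lap_mult_le[OF sg that])
  have root_not: "\<not> lap_determining n E \<mu> {r}"
    using large[of "{r}"] m2 root_less by auto
  let ?H = twigs
  have "\<not> lap_determining n E \<mu> {p}" using large[of "{p}"] m2 inner_less by auto
  then obtain q where "q \<in> children r" "q \<noteq> p" "children q \<noteq> {}"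
    using inner_determining[OF 1] by blast
  hence "lap_determining n E \<mu> (?H - {p})" by (rule twigs_determining[OF 1])
  hence "lap_mult n E \<mu> \<le> card (?H - {p})" by (intro large) (auto simp: twigs_def)
  hence Hge: "lap_mult n E \<mu> + 1 \<le> card ?H"
    using inner_in_twigs twigs_finite m2 by (simp add: card_Diff_singleton)
  define g where "g h = (SOME w. w \<in> children h)" for h
  have HD: "h < n" "h \<noteq> r" "g h \<in> children h" "\<And>w. w \<in> children h \<Longrightarrow> children w = {}" if "h \<in> ?H" for h
    using that some_in_eq[of "children h"] by (auto simp: twigs_def g_def)
  have gD: "g h < n" "g h \<noteq> r" "par (g h) = h" "children (g h) = {}" if "h \<in> ?H" for h
    using childrenD[OF HD(3)[OF that]] HD(4)[OF that HD(3)[OF that]] by auto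
  have gH: "h' \<noteq> g h" if "h \<in> ?H" "h' \<in> ?H" for h h' using HD(3)[OF that(2)] gD(4)[OF that(1)] by auto
  have inj: "inj_on g ?H" by (rule inj_onI) (metis gD(3))
  define U where "U = insert r (?H \<union> g ` ?H)"
  have Un: "U \<subseteq> {..<n}" using root_less HD(1) gD(1) by (auto simp: U_def)
  have cU: "card U = 2 * card ?H + 1"
  proof -
    have "r \<notin> ?H \<union> g ` ?H" using HD(2) gD(2) by fastforce
    hence "card U = Suc (card (?H \<union> g ` ?H))" using twigs_finite by (simp add: U_def)
    also have "card (?H \<union> g ` ?H) = card ?H + card (g ` ?H)"
      by (rule card_Un_disjoint) (use twigs_finite gH in blast)+
    finally show ?thesis using card_image[OF inj] by simp
  qed
  have "card U \<le> n" using card_mono[OF _ Un] by simp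
  \<comment> \<open>Root, twigs and chosen leaves fit into \<open>2 * lap_mult n E \<mu> + 4\<close>
    vertices, which leaves room for at most \<open>lap_mult n E \<mu> + 1\<close> twigs and, at that
    number, for one more vertex \<open>e\<close>.\<close>
  hence cH: "card ?H = lap_mult n E \<mu> + 1" using cU Hge mult by linarith
  have "card ({..<n} - U) = 1"
    using card_Diff_subset[OF _ Un] cU cH mult finite_subset[OF Un] by simp
  then obtain e where e: "{..<n} - U = {e}" by (meson card_1_singletonE)
  have en: "e < n" "e \<noteq> r" "e \<notin> ?H" "\<And>h. h \<in> ?H \<Longrightarrow> e \<noteq> g h" using e by (auto simp: U_def)
  have V: "{..<n} = insert r (insert e (?H \<union> g ` ?H))" using e Un by (auto simp: U_def)
  have Vc: "v = r \<or> v = e \<or> v \<in> ?H \<or> (\<exists>h\<in>?H. v = g h)" if "v < n" for v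
  proof -
    have "v \<in> {..<n}" using that by simp
    thus ?thesis unfolding V by blast
  qed
  have nonleaf: "v = r \<or> v = e \<or> v \<in> ?H" if "v < n" "children v \<noteq> {}" for v
    using Vc[OF that(1)] that(2) gD(4) by auto
  \<comment> \<open>The parent of a twig has a child that is not a leaf, so it is not a twig
    itself.\<close>
  have par_twig: "par h = r \<or> par h = e" if "h \<in> ?H" for h
  proof -
    note h = HD[OF that]
    have "h \<in> children (par h)" using h(1,2) by (rule in_children_par)
    moreover have "children h \<noteq> {}" using h(3) by blast
    ultimately have "par h \<notin> ?H" by (auto dest: HD(4))
    thus ?thesis using nonleaf[OF par_less[OF h(1,2)]] \<open>h \<in> children (par h)\<close> by blast
  qed
  have nbr_leaf: "nbrs n E (g h) = {h}" if "h \<in> ?H" for h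
    using nbrs_nonroot[OF gD(1,2)[OF that]] gD(3,4)[OF that] by simp
  have children_twig: "children h = insert (g h) {w. w = e \<and> par e = h}" if h: "h \<in> ?H" for h
  proof
    show "insert (g h) {w. w = e \<and> par e = h} \<subseteq> children h"
      using HD(3)[OF h] in_children_par[OF en(1,2)] by auto
    show "children h \<subseteq> insert (g h) {w. w = e \<and> par e = h}"
    proof
      fix w assume w: "w \<in> children h"
      have "w \<notin> ?H" using HD(4)[OF h w] HD(3)[of w] by auto
      then consider "w = e" | h' where "h' \<in> ?H" "w = g h'"
        using Vc[OF childrenD(1)[OF w]] childrenD(2)[OF w] by blast
      thus "w \<in> insert (g h) {w. w = e \<and> par e = h}"
      proof cases
        case 1
        thus ?thesis using childrenD(3)[OF w] by simp
      next
        case 2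
        thus ?thesis using childrenD(3)[OF w] gD(3)[OF 2(1)] by simp
      qed
    qed
  qed
  have nbr_twig: "nbrs n E h = insert (par h) (insert (g h) {w. w = e \<and> par e = h})" if "h \<in> ?H" for h
    using nbrs_nonroot[OF HD(1,2)[OF that]] children_twig[OF that] by simp
  have child_if: "children v = {h \<in> insert e ?H. par h = v}" if v: "v \<notin> ?H" for v
  proof (rule Set.set_eqI)
    fix w show "w \<in> children v \<longleftrightarrow> w \<in> {h \<in> insert e ?H. par h = v}"
      using Vc[of w] v gD(3) HD(1,2) en by (auto simp: children_def)
  qed
  have r_H: "r \<notin> ?H" using HD(2) by blast
  have leaf: "x h = (1 - \<mu>) * x (g h)" if "lap_eigenfun n E \<mu> x" "h \<in> ?H" for x h
    by (rule lap_eigenfun_leaf[OF that(1) gD(1)[OF that(2)] nbr_leaf[OF that(2)]])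
  have leg: "x (par h) = (\<mu>\<^sup>2 - 3 * \<mu> + 1) * x (g h)"
    if x: "lap_eigenfun n E \<mu> x" and h: "h \<in> ?H" and ne: "par e \<noteq> h" for x h
  proof (rule lap_eigenfun_pendant_path(2)[OF x HD(1)[OF h] gD(1)[OF h] _ _ nbr_leaf[OF h]])
    show "par h \<noteq> g h" using par_twig[OF h] gD(2)[OF h] en(4)[OF h] by auto
    show "nbrs n E h = {par h, g h}" using nbr_twig[OF h] ne by simp
  qed
  have all_zero: "x v = 0" if "lap_eigenfun n E \<mu> x" "x r = 0" "x e = 0" "\<And>h. h \<in> ?H \<Longrightarrow> x h = 0" "v < n"
    for x v
    using Vc[OF that(5)] that(2-4) leaf[OF that(1)] 1 by auto
  \<comment> \<open>With two twigs omitted, the set is one smaller than the multiplicity.\<close>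
  have too_small: False
    if "a \<in> ?H" "b \<in> ?H" "a \<noteq> b" "lap_determining n E \<mu> (?H - {a, b})" for a b
  proof -
    have "lap_mult n E \<mu> \<le> card (?H - {a, b})" by (rule large) (use that HD(1) in auto)
    also have "\<dots> = card ?H - card {a, b}" by (rule card_Diff_subset) (use that in auto)
    finally show False using cH that(3) m2 by simp
  qed
  have "par e < n" using par_less[OF en(1,2)] .
  moreover have "par e \<noteq> e" using depth_par[OF en(1,2)] by auto
  moreover have "children (par e) \<noteq> {}" using in_children_par[OF en(1,2)] by blast
  ultimately have par_e: "par e = r \<or> par e \<in> ?H" using nonleaf by blast
  show ?thesis
  proof (cases "par e = r")
    \<comment> \<open>Here \<open>e\<close> is a second leaf at a twig \<open>h0\<close>, and all
      twigs hang at the root.\<close>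
    case False
    define h0 where "h0 = par e"
    have h0: "h0 \<in> ?H" using par_e False by (simp add: h0_def)
    have ce: "children e = {}"
      using HD(4)[OF h0] in_children_par[OF en(1,2)] by (simp add: h0_def)
    have ph: "par h = r" if "h \<in> ?H" for h
      using par_twig[OF that] in_children_par[OF HD(1,2)[OF that]] ce by auto
    have nr: "nbrs n E r = ?H" using nbrs_root child_if[OF r_H] ph False by auto
    have ne: "nbrs n E e = {h0}" using nbrs_nonroot[OF en(1,2)] ce by (simp add: h0_def)
    show ?thesis
    proof (cases "\<mu>\<^sup>2 - 3 * \<mu> + 1 = 0")
      case False
      have "lap_determining n E \<mu> {r}"
      proof (rule lap_determiningI)
        fix x v assume x: "lap_eigenfun n E \<mu> x" "\<And>s. s \<in> {r} \<Longrightarrow> x s = 0" and v: "v < n"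
        have xr: "x r = 0" using x(2) by simp
        have xh: "x h = 0" if h: "h \<in> ?H" "h \<noteq> h0" for h
          using leg[OF x(1) h(1)] leaf[OF x(1) h(1)] h False xr ph[OF h(1)] by (auto simp: h0_def)
        have xh0: "x h0 = 0"
          by (rule lap_eigenfun_nbr_zero[OF x(1) root_less xr]) (use nr h0 xh in auto)
        have "x e = 0" by (rule lap_eigenfun_leaf_zero[OF x(1) en(1) ne xh0 1])
        thus "x v = 0" using all_zero[OF x(1) xr _ _ v] xh xh0 by blast
      qed
      thus ?thesis using root_not by blast
    next
      case True
      have \<mu>0: "\<mu> \<noteq> 0" using True by auto
      have "card (?H - {h0}) \<noteq> 0" using cH m2 h0 twigs_finite by simp
      then obtain h1 where h1: "h1 \<in> ?H" "h1 \<noteq> h0" by (metis card_eq_0_iff DiffE ex_in_conv singletonI)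
      have "lap_determining n E \<mu> (?H - {h0, h1})"
      proof (rule lap_determiningI)
        fix x v assume x: "lap_eigenfun n E \<mu> x" "\<And>s. s \<in> ?H - {h0, h1} \<Longrightarrow> x s = 0" and v: "v < n"
        have xr: "x r = 0" using leg[OF x(1) h1(1)] h1(2) True ph[OF h1(1)] by (auto simp: h0_def)
        define t where "t = x (g h0)"
        have xh0: "x h0 = (1 - \<mu>) * t" using leaf[OF x(1) h0] by (simp add: t_def)
        have "x h0 = (1 - \<mu>) * x e" by (rule lap_eigenfun_leaf[OF x(1) en(1) ne])
        hence xe: "x e = t" using xh0 1 by simp
        have nh0: "nbrs n E h0 = {r, g h0, e}" using nbr_twig[OF h0] ph[OF h0] by (auto simp: h0_def)
        have "x r + x (g h0) + x e = (3 - \<mu>) * x h0"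
          using lap_eigenfunD[OF x(1) HD(1)[OF h0]] en(2) en(4)[OF h0] gD(2)[OF h0] unfolding nh0 by simp
        hence "2 * t = (3 - \<mu>) * ((1 - \<mu>) * t)" using xr xe xh0 by (simp add: t_def)
        \<comment> \<open>The extra leaf at \<open>h0\<close> shifts the quadratic by
          \<open>- \<mu>\<close>. At a golden root only this nonzero shift remains, so
          \<open>h0\<close> and its leaves vanish, and the equation at the root then gives
          \<open>h1\<close>.\<close>
        hence "(\<mu>\<^sup>2 - 3 * \<mu> + 1) * t - \<mu> * t = 0" by (simp add: algebra_simps power2_eq_square)
        hence t: "t = 0" using True \<mu>0 by simp
        have x0: "x h0 = 0" using xh0 t by simp
        have x1: "x h1 = 0"
          by (rule lap_eigenfun_nbr_zero[OF x(1) root_less xr]) (use nr h1 x(2) x0 in auto)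
        show "x v = 0" by (rule all_zero[OF x(1) xr _ _ v]) (use xe t x(2) x0 x1 in auto)
      qed
      thus ?thesis using too_small h0 h1 by blast
    qed
  next
    \<comment> \<open>Here \<open>e\<close> is a child of the root and may still carry
      twigs.\<close>
    case True
    have pe: "par e \<noteq> h" if "h \<in> ?H" for h using True HD(2)[OF that] by auto
    have nr: "nbrs n E r = insert e {h \<in> ?H. par h = r}"
      using nbrs_root child_if[OF r_H] True by auto
    have ne: "nbrs n E e = insert r {h \<in> ?H. par h = e}"
    proof -
      have "par e \<noteq> e" using True en(2) by simp
      hence "children e = {h \<in> ?H. par h = e}" unfolding child_if[OF en(3)] by blast
      thus ?thesis using nbrs_nonroot[OF en(1,2)] True by simp
    qed
    \<comment> \<open>Otherwise vanishing at the root passes to the twigs there, then to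
      \<open>e\<close> by the equation at the root, then to the twigs at \<open>e\<close>.\<close>
    have good: "\<mu>\<^sup>2 - 3 * \<mu> + 1 = 0"
    proof (rule ccontr)
      assume bad: "\<mu>\<^sup>2 - 3 * \<mu> + 1 \<noteq> 0"
      have "lap_determining n E \<mu> {r}"
      proof (rule lap_determiningI)
        fix x v assume x: "lap_eigenfun n E \<mu> x" "\<And>s. s \<in> {r} \<Longrightarrow> x s = 0" and v: "v < n"
        have xr: "x r = 0" using x(2) by simp
        have xh: "x h = 0" if h: "h \<in> ?H" and "x (par h) = 0" for h
          using leg[OF x(1) h pe[OF h]] leaf[OF x(1) h] that bad by auto
        have xe: "x e = 0"
          by (rule lap_eigenfun_nbr_zero[OF x(1) root_less xr]) (use nr xh xr in auto)
        show "x v = 0" by (rule all_zero[OF x(1) xr xe _ v]) (use xh par_twig xr xe in metis)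
      qed
      thus False using root_not by blast
    qed
    \<comment> \<open>A twig \<open>h\<close> at \<open>e\<close> would force
      \<open>x e = 0\<close>, as \<open>p\<close> forces \<open>x r = 0\<close>. The equations at
      the root and at \<open>e\<close> then recover \<open>p\<close> and \<open>h\<close>, so both
      could be omitted.\<close>
    have ph: "par h = r" if "h \<in> ?H" for h
    proof (rule ccontr)
      assume "par h \<noteq> r"
      hence he: "par h = e" using par_twig[OF that] by blast
      have hp: "h \<noteq> p" using par_inner he en(2) by auto
      have "lap_determining n E \<mu> (?H - {h, p})"
      proof (rule lap_determiningI)
        fix x v assume x: "lap_eigenfun n E \<mu> x" "\<And>s. s \<in> ?H - {h, p} \<Longrightarrow> x s = 0" and v: "v < n"
        have xr: "x r = 0" using leg[OF x(1) inner_in_twigs pe[OF inner_in_twigs]] good par_inner by simp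
        have xe: "x e = 0" using leg[OF x(1) that pe[OF that]] good he by simp
        have xp: "x p = 0"
          by (rule lap_eigenfun_nbr_zero[OF x(1) root_less xr])
             (use nr inner_in_twigs par_inner x(2) xe he en(2) in auto)
        have xh: "x h = 0"
          by (rule lap_eigenfun_nbr_zero[OF x(1) en(1) xe]) (use ne that he x(2) xr xp in auto)
        show "x v = 0" by (rule all_zero[OF x(1) xr xe _ v]) (use x(2) xp xh in blast)
      qed
      thus False using too_small that inner_in_twigs hp by blast
    qed
    have "spider_at n E r e ?H g"
    proof
      show "nbrs n E r = insert e ?H" using nr ph by blast
      show "nbrs n E e = {r}" using ne ph en(2) by force
      fix h assume h: "h \<in> ?H"
      show "nbrs n E h = {r, g h}" using nbr_twig[OF h] ph[OF h] pe[OF h] by simp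
      show "nbrs n E (g h) = {h}" by (rule nbr_leaf[OF h])
      show "r \<noteq> g h" using gD(2)[OF h] by simp
    qed (use V en r_H gH inj in auto)
    thus ?thesis using that good by blast
  qed
qed

end

section \<open>From rooted trees to the characterisation\<close>

text \<open>In a star the centre alone is determining, so the multiplicity is too small. Any other
  tree is rooted at the parent of an inner vertex all of whose other neighbours are leaves.\<close>

lemma tree_multiplicity_spider:
  assumes T: "is_tree n E" and 1: "\<mu> \<noteq> 1"
    and mult: "2 * lap_mult n E \<mu> + 4 = n" and n8: "8 \<le> n"
  obtains c e H g where "spider_at n E c e H g" "\<mu>\<^sup>2 - 3 * \<mu> + 1 = 0"
  using T
proof (cases rule: tree_star_or_inner)
  case (star r)
  have "lap_determining n E \<mu> {r}"
  proof (rule lap_determiningI)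
    fix x v assume x: "lap_eigenfun n E \<mu> x" "\<And>s. s \<in> {r} \<Longrightarrow> x s = 0" and v: "v < n"
    show "x v = 0" using lap_eigenfun_leaf_zero[OF x(1) v star(2)[OF v] x(2) 1] x(2) by auto
  qed
  hence "lap_mult n E \<mu> \<le> card {r}" using star(1) by (intro lap_mult_le tree_simple T) auto
  thus ?thesis using mult n8 by simp
next
  case (inner c p l)
  obtain par d where "rooted_tree n E c par d" using tree_rooted[OF T inner(1)] .
  then interpret rooted_tree n E c par d .
  have "p \<noteq> c" using inner(1,3) tree_simple[OF T] by (auto simp: simple_graph_def)
  moreover have "par p = c" using inner(1-3) adj_iff[of p c] by simp
  moreover have np: "nbrs n E p = insert c (children p)"
    using nbrs_nonroot[OF inner(2)] calculation by simp
  moreover have "l \<in> children p" using np inner(4,5) by simp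
  moreover have "children w = {}" if w: "w \<in> children p" for w
  proof -
    have "nbrs n E w = {p}" using inner(6)[of w] np w childrenD(2)[OF w] by simp
    moreover have "p \<notin> children w" using \<open>par p = c\<close> childrenD(2)[OF w] childrenD(3)[of p w] by auto
    ultimately show ?thesis using nbrs_nonroot[OF childrenD(1,2)[OF w]] by auto
  qed
  ultimately have "rooted_tree_inner n E c par d p"
    using inner(2) by unfold_locales auto
  then interpret rooted_tree_inner n E c par d p .
  obtain e H g where "spider_at n E c e H g" "\<mu>\<^sup>2 - 3 * \<mu> + 1 = 0"
    using spider_if_multiplicity[OF tree_simple[OF T] 1 mult n8] .
  thus ?thesis by (rule that)
qed

lemma golden_roots_iff:
  fixes \<mu> :: real
  shows "\<mu>\<^sup>2 - 3 * \<mu> + 1 = 0 \<longleftrightarrow> \<mu> = (3 + sqrt 5) / 2 \<or> \<mu> = (3 - sqrt 5) / 2"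
proof -
  have "\<mu>\<^sup>2 - 3 * \<mu> + 1 = (\<mu> - (3 + sqrt 5) / 2) * (\<mu> - (3 - sqrt 5) / 2)"
    by (simp add: field_simps power2_eq_square)
  thus ?thesis by simp
qed

theorem theorem4p5:
  fixes n :: nat and E :: "nat \<Rightarrow> nat \<Rightarrow> bool" and \<mu> :: real
  assumes "is_tree n E" and "n \<ge> 8"
    and "eigenvalue (laplacian n E :: real mat) \<mu>" and "\<mu> \<noteq> 1"
  shows "(real (lap_mult n E \<mu>) = real n / 2 - 2 \<longleftrightarrow>
           (even n \<and> graph_iso n E (n div 2 + (n div 2 - 1) + 1)
                          (spider_adj (n div 2) (n div 2 - 1)) \<and>
            (\<mu> = (3 + sqrt 5) / 2 \<or> \<mu> = (3 - sqrt 5) / 2)))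
       \<and> (real (lap_mult n E \<mu>) = real n / 2 - 2 \<longrightarrow>
           \<mu> = alg_conn n E \<or> lap_conjugates n E \<mu> (alg_conn n E))"
proof -
  note T = assms(1) and n8 = assms(2)
  have sg: "simple_graph n E" by (rule tree_simple[OF T])
  \<comment> \<open>Over the naturals the condition contains the evenness of
    \<open>n\<close>.\<close>
  have mult_iff: "real (lap_mult n E \<mu>) = real n / 2 - 2 \<longleftrightarrow> 2 * lap_mult n E \<mu> + 4 = n" by linarith
  define k where "k = n div 2 - 1"
  have k: "n div 2 = Suc k" using n8 by (simp add: k_def)
  have forward: "even n \<and> graph_iso n E (Suc k + k + 1) (spider_adj (Suc k) k) \<and>
      \<mu>\<^sup>2 - 3 * \<mu> + 1 = 0 \<and> lap_conjugates n E \<mu> (alg_conn n E)"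
    if mult: "2 * lap_mult n E \<mu> + 4 = n"
  proof -
    obtain c e H g where "spider_at n E c e H g" and \<mu>: "\<mu>\<^sup>2 - 3 * \<mu> + 1 = 0"
      using tree_multiplicity_spider[OF T assms(4) mult n8] .
    then interpret spider_at n E c e H g by blast
    have cH: "card H = k" using card_vertices k by linarith
    have "alg_conn n E = (3 - sqrt 5) / 2" using alg_conn_eq[OF sg] cH k n8 by simp
    \<comment> \<open>The algebraic connectivity is itself a golden root, so conjugacy holds
      whichever of the two roots \<mu> is.\<close>
    hence "(alg_conn n E)\<^sup>2 - 3 * alg_conn n E + 1 = 0" using golden_roots_iff by blast
    moreover have "lap_mult n E \<mu> > 0" using mult n8 by simp
    ultimately have "lap_conjugates n E \<mu> (alg_conn n E)" by (intro lap_conjugates_golden \<mu>)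
    thus ?thesis using iso_spider[OF cH] \<mu> mult by presburger
  qed
  have backward: "2 * lap_mult n E \<mu> + 4 = n"
    if ev: "even n" and iso: "graph_iso n E (Suc k + k + 1) (spider_adj (Suc k) k)"
      and \<mu>: "\<mu>\<^sup>2 - 3 * \<mu> + 1 = 0"
  proof -
    obtain c e H g where "spider_at n E c e H g" and cH: "card H = k"
      using spider_at_if_iso[OF iso] .
    then interpret spider_at n E c e H g by blast
    have "H \<noteq> {}" using cH k n8 by auto
    hence "lap_mult n E \<mu> = k - 1" using golden_mult[OF sg \<mu>] cH by simp
    thus ?thesis using card_vertices cH n8 by simp
  qed
  show ?thesis
    unfolding mult_iff k golden_roots_iff[symmetric] diff_Suc_1 using forward backward by blast
qed

end
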